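(* Let $\mathcal{C}$ be a smooth, addable class of graphs and let $c$ be the limiting probability (as $n\to\infty$) that $R_n(\mathcal{C})$ is not connected. Then, for any MSO sentence $\phi$, the probability that $R_n(\mathcal{C})$ satisfies $\phi$ converges to a value $p$ such that either $p\le c$ or $p\ge 1-c$.
   Context: Graphs are finite, simple and undirected; classes of graphs are closed under isomorphism. $\mathcal{C}_n$ is the set of graphs in $\mathcal{C}$ with vertex set $[n]$, and $R_n(\mathcal{C})$ is drawn uniformly from $\mathcal{C}_n$. $\mathcal{C}$ is decomposable if $G\in\mathcal{C}$ iff every connected component of $G$ is in $\mathcal{C}$; bridge-addable if for every $G\in\mathcal{C}$ and vertices $u,v$ in distinct components of $G$, adding the edge $\{u,v\}$ yields a graph in $\mathcal{C}$; addable if both. $\mathcal{C}$ is smooth if $|\mathcal{C}_n|/(n|\mathcal{C}_{n-1}|)$ tends to a finite limit. MSO formulas over graphs are built from $x\in X$ and $E(x,y)$ using Boolean connectives and first- and second-order quantifiers. *)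

theory Defs
  imports "HOL-Probability.Probability_Mass_Function"
begin

type_synonym 'v graph = "'v set \<times> 'v set set"

abbreviation verts :: "'v graph \<Rightarrow> 'v set" where
  "verts G \<equiv> fst G"

abbreviation edges :: "'v graph \<Rightarrow> 'v set set" where
  "edges G \<equiv> snd G"

definition simple_graph :: "'v graph \<Rightarrow> bool" where
  "simple_graph G \<longleftrightarrow> finite (verts G) \<and> (\<forall>e\<in>edges G. e \<subseteq> verts G \<and> card e = 2)"

definition graph_iso :: "'v graph \<Rightarrow> 'w graph \<Rightarrow> bool" where
  "graph_iso G H \<longleftrightarrow> (\<exists>f. bij_betw f (verts G) (verts H) \<and>
     (\<forall>u\<in>verts G. \<forall>v\<in>verts G. {u, v} \<in> edges G \<longleftrightarrow> {f u, f v} \<in> edges H))"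

definition adj :: "'v graph \<Rightarrow> ('v \<times> 'v) set" where
  "adj G = {(u, v). {u, v} \<in> edges G}"

definition induced :: "'v graph \<Rightarrow> 'v set \<Rightarrow> 'v graph" where
  "induced G S = (S, {e \<in> edges G. e \<subseteq> S})"

definition component :: "'v graph \<Rightarrow> 'v \<Rightarrow> 'v graph" where
  "component G v = induced G {u \<in> verts G. (v, u) \<in> (adj G)\<^sup>*}"

definition components :: "'v graph \<Rightarrow> 'v graph set" where
  "components G = component G ` verts G"

definition graph_connected :: "'v graph \<Rightarrow> bool" where
  "graph_connected G \<longleftrightarrow> verts G \<noteq> {} \<and>
     (\<forall>u\<in>verts G. \<forall>v\<in>verts G. (u, v) \<in> (adj G)\<^sup>*)"

definition add_edge :: "'v graph \<Rightarrow> 'v \<Rightarrow> 'v \<Rightarrow> 'v graph" where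
  "add_edge G u v = (verts G, insert {u, v} (edges G))"

text \<open>Every finite graph has a copy with vertices in \<open>nat\<close>, so an isomorphism-closed class of
  finite graphs is determined by its members whose vertices are natural numbers.\<close>

definition graph_class :: "nat graph set \<Rightarrow> bool" where
  "graph_class C \<longleftrightarrow> (\<forall>G\<in>C. simple_graph G) \<and>
     (\<forall>G\<in>C. \<forall>H. simple_graph H \<and> graph_iso G H \<longrightarrow> H \<in> C)"

definition graphs_on :: "nat graph set \<Rightarrow> nat \<Rightarrow> nat graph set" where
  "graphs_on C n = {G \<in> C. verts G = {1..n}}"

definition decomposable :: "nat graph set \<Rightarrow> bool" where
  "decomposable C \<longleftrightarrow> (\<forall>G. simple_graph G \<longrightarrow> (G \<in> C \<longleftrightarrow> components G \<subseteq> C))"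

definition bridge_addable :: "nat graph set \<Rightarrow> bool" where
  "bridge_addable C \<longleftrightarrow> (\<forall>G\<in>C. \<forall>u\<in>verts G. \<forall>v\<in>verts G.
     component G u \<noteq> component G v \<longrightarrow> add_edge G u v \<in> C)"

definition addable :: "nat graph set \<Rightarrow> bool" where
  "addable C \<longleftrightarrow> decomposable C \<and> bridge_addable C"

text \<open>The first conjunct says that the quotients (and the uniform distributions) are defined for
  all large \<open>n\<close>. Without it, since \<open>x / 0 = 0\<close>, the class of all graphs whose components have even
  order would count as smooth.\<close>

definition smooth :: "nat graph set \<Rightarrow> bool" where
  "smooth C \<longleftrightarrow> (\<forall>\<^sub>F n in sequentially. graphs_on C n \<noteq> {}) \<and>
     (\<exists>L::real. (\<lambda>n. real (card (graphs_on C n)) / (real n * real (card (graphs_on C (n - 1)))))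
        \<longlonglongrightarrow> L)"

lemma finite_graphs_on:
  assumes "graph_class C"
  shows "finite (graphs_on C n)"
proof (rule finite_subset)
  show "graphs_on C n \<subseteq> {{1..n}} \<times> Pow (Pow {1..n})"
    using assms by (auto simp: graphs_on_def graph_class_def simple_graph_def; fastforce)
qed auto

text \<open>Only meaningful when \<open>graphs_on C n\<close> is nonempty.\<close>

definition random_graph :: "nat graph set \<Rightarrow> nat \<Rightarrow> nat graph pmf" where
  "random_graph C n = pmf_of_set (graphs_on C n)"

text \<open>First-order variables and set variables are both named by natural numbers, in separate name
  spaces. Equality is not primitive; it is definable, as \<open>x = y\<close> iff \<open>x\<close> and \<open>y\<close> lie in the same
  sets.\<close>

datatype mso =
    Mem nat nat
  | Edge nat nat
  | Neg mso
  | Conj mso mso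
  | Disj mso mso
  | ExV nat mso
  | AllV nat mso
  | ExS nat mso
  | AllS nat mso

primrec sat :: "'v graph \<Rightarrow> (nat \<Rightarrow> 'v) \<Rightarrow> (nat \<Rightarrow> 'v set) \<Rightarrow> mso \<Rightarrow> bool" where
  "sat G a A (Mem x X) \<longleftrightarrow> a x \<in> A X"
| "sat G a A (Edge x y) \<longleftrightarrow> {a x, a y} \<in> edges G"
| "sat G a A (Neg \<phi>) \<longleftrightarrow> \<not> sat G a A \<phi>"
| "sat G a A (Conj \<phi> \<psi>) \<longleftrightarrow> sat G a A \<phi> \<and> sat G a A \<psi>"
| "sat G a A (Disj \<phi> \<psi>) \<longleftrightarrow> sat G a A \<phi> \<or> sat G a A \<psi>"
| "sat G a A (ExV x \<phi>) \<longleftrightarrow> (\<exists>v\<in>verts G. sat G (a(x := v)) A \<phi>)"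
| "sat G a A (AllV x \<phi>) \<longleftrightarrow> (\<forall>v\<in>verts G. sat G (a(x := v)) A \<phi>)"
| "sat G a A (ExS X \<phi>) \<longleftrightarrow> (\<exists>S\<subseteq>verts G. sat G a (A(X := S)) \<phi>)"
| "sat G a A (AllS X \<phi>) \<longleftrightarrow> (\<forall>S\<subseteq>verts G. sat G a (A(X := S)) \<phi>)"

primrec free_vars :: "mso \<Rightarrow> nat set" where
  "free_vars (Mem x X) = {x}"
| "free_vars (Edge x y) = {x, y}"
| "free_vars (Neg \<phi>) = free_vars \<phi>"
| "free_vars (Conj \<phi> \<psi>) = free_vars \<phi> \<union> free_vars \<psi>"
| "free_vars (Disj \<phi> \<psi>) = free_vars \<phi> \<union> free_vars \<psi>"
| "free_vars (ExV x \<phi>) = free_vars \<phi> - {x}"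
| "free_vars (AllV x \<phi>) = free_vars \<phi> - {x}"
| "free_vars (ExS X \<phi>) = free_vars \<phi>"
| "free_vars (AllS X \<phi>) = free_vars \<phi>"

primrec free_set_vars :: "mso \<Rightarrow> nat set" where
  "free_set_vars (Mem x X) = {X}"
| "free_set_vars (Edge x y) = {}"
| "free_set_vars (Neg \<phi>) = free_set_vars \<phi>"
| "free_set_vars (Conj \<phi> \<psi>) = free_set_vars \<phi> \<union> free_set_vars \<psi>"
| "free_set_vars (Disj \<phi> \<psi>) = free_set_vars \<phi> \<union> free_set_vars \<psi>"
| "free_set_vars (ExV x \<phi>) = free_set_vars \<phi>"
| "free_set_vars (AllV x \<phi>) = free_set_vars \<phi>"
| "free_set_vars (ExS X \<phi>) = free_set_vars \<phi> - {X}"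
| "free_set_vars (AllS X \<phi>) = free_set_vars \<phi> - {X}"

definition mso_sentence :: "mso \<Rightarrow> bool" where
  "mso_sentence \<phi> \<longleftrightarrow> free_vars \<phi> = {} \<and> free_set_vars \<phi> = {}"

lemma sat_cong:
  assumes "\<And>x. x \<in> free_vars \<phi> \<Longrightarrow> a x = b x"
    and "\<And>X. X \<in> free_set_vars \<phi> \<Longrightarrow> A X = B X"
  shows "sat G a A \<phi> \<longleftrightarrow> sat G b B \<phi>"
  using assms
proof (induction \<phi> arbitrary: a b A B)
  case (Neg \<phi>)
  then show ?case by (metis free_vars.simps(3) free_set_vars.simps(3) sat.simps(3))
next
  case (Conj \<phi> \<psi>)
  then show ?case
    by (metis UnCI free_vars.simps(4) free_set_vars.simps(4) sat.simps(4))
next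
  case (Disj \<phi> \<psi>)
  then show ?case
    by (metis UnCI free_vars.simps(5) free_set_vars.simps(5) sat.simps(5))
next
  case (ExV x \<phi>)
  have "sat G (a(x := v)) A \<phi> = sat G (b(x := v)) B \<phi>" for v
    by (rule ExV.IH) (use ExV.prems in auto)
  then show ?case by simp
next
  case (AllV x \<phi>)
  have "sat G (a(x := v)) A \<phi> = sat G (b(x := v)) B \<phi>" for v
    by (rule AllV.IH) (use AllV.prems in auto)
  then show ?case by simp
next
  case (ExS X \<phi>)
  have "sat G a (A(X := S)) \<phi> = sat G b (B(X := S)) \<phi>" for S
    by (rule ExS.IH) (use ExS.prems in auto)
  then show ?case by simp
next
  case (AllS X \<phi>)
  have "sat G a (A(X := S)) \<phi> = sat G b (B(X := S)) \<phi>" for S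
    by (rule AllS.IH) (use AllS.prems in auto)
  then show ?case by simp
qed auto

definition models :: "'v graph \<Rightarrow> mso \<Rightarrow> bool" where
  "models G \<phi> \<longleftrightarrow> (\<forall>a A. sat G a A \<phi>)"

lemma models_sentence_iff:
  assumes "mso_sentence \<phi>"
  shows "models G \<phi> \<longleftrightarrow> sat G a A \<phi>"
  using assms sat_cong[of \<phi>] unfolding models_def mso_sentence_def by blast

end

theory Submission
  imports Defs "HOL-Library.FSet" "HOL-Library.Multiset"
begin

text \<open>
  Rank \<open>k\<close> MSO types of rooted graphs compose under adding an edge between two roots, and
  attaching more and more copies of the same type eventually changes nothing. Hence among the
  finitely many types of rooted connected members of the class there is an absorbing one,
  realised by some \<open>(M, r)\<close>. A connected member \<open>G\<close> with a pendant copy of \<open>M\<close>, joined to an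
  arbitrary rest of type \<open>t\<close> by a single edge at \<open>r\<close>, has rooted type \<open>m t = (m m) t = (m t) m\<close>,
  which re-rooted in the last factor is \<open>m (m t) = m\<close>. So all such \<open>G\<close> satisfy the same sentences,
  even if the rest is not in the class (addability does not allow removing bridges). Attaching one
  copy of \<open>M\<close> to a connected graph without pendant copies is injective, and by smoothness this
  makes such graphs a fraction \<open>O(1 / n)\<close> of the class.

  By counting pairs of a graph and a bridge, the part outside the giant component is bounded in
  probability and the probability of being connected is bounded below. Splitting off the small part
  multiplies counts by asymptotically constant factors; this gives the factorial moments of the
  number of small components, hence the limit of the probability of connectedness, and then the
  limit for every sentence.
\<close>

section \<open>Types of rooted graphs\<close>

text \<open>Types are abstract trees with a total operation \<open>glue\<close>, so commutation and
  saturation are proved by induction on trees, without graphs realising them. The limit for a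
  sentence \<open>\<phi>\<close> is found by fixing the order \<open>h\<close> of the part outside
  the giant component. Up to a vanishing error the giant component has one fixed type, so the truth
  of \<open>\<phi>\<close> depends only on the type of the small part. The count then factors into a
  constant given by the graphs on \<open>h\<close> vertices, the quotient
  \<open>weight (n - h) / weight n\<close> and a probability for graphs on \<open>n - h\<close>
  vertices. Summing over \<open>h \<le> K\<close> leaves an error of at most
  \<open>2 / (K + 1)\<close>, uniformly in large \<open>n\<close>. These quotients converge only if
  the limit ratio \<open>growth\<close> is positive, while smoothness by itself permits the value
  \<open>0\<close>. Positivity comes from counting again: for \<open>n > f\<close>, a graph on
  \<open>n + f\<close> vertices has at most one closed set of order \<open>f\<close> with connected
  complement, whereas a constant proportion of the graphs on \<open>n\<close> vertices is connected
  and can receive such a piece.\<close>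

type_synonym atom = "nat set \<times> (nat \<times> nat) set \<times> (nat \<times> nat) set \<times> nat set"

text \<open>The tree of a back-and-forth game: the label holds the quantifier-free data on the
  current parameters, a child is the type reached by one more set parameter. Children form a set, so
  the number of choices leading to the same child is forgotten; finiteness of the set of types rests
  on this.\<close>

datatype ty = Node (lab: atom) (kids: "ty fset")

text \<open>The data of a join of two disjoint graphs, rooted where the first one is. That
  \<open>(i, i)\<close> lies in \<open>I\<close> means that the \<open>i\<close>-th set is nonempty,
  so an index with this property in both factors yields two elements. The products of
  \<open>R\<close> and \<open>R'\<close> are the edges between the roots; the root marks of the
  second factor are lost.\<close>

fun merge_atoms :: "atom \<Rightarrow> atom \<Rightarrow> atom" where
  "merge_atoms (B, I, E, R) (B', I', E', R') =
     (B \<union> B' \<union> {i. (i, i) \<in> I \<inter> I'}, I \<union> I', E \<union> E' \<union> R \<times> R' \<union> R' \<times> R, R)"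

text \<open>Composition in the style of Feferman and Vaught: a set in a disjoint union is a pair of
  sets, so every child of one tree is combined with every child of the other.\<close>

primrec glue :: "ty \<Rightarrow> ty \<Rightarrow> ty" where
  "glue (Node a X) =
     (\<lambda>t. Node (merge_atoms a (lab t)) (ffUnion ((\<lambda>f. f |`| kids t) |`| (glue |`| X))))"

lemma lab_glue [simp]: "lab (glue s t) = merge_atoms (lab s) (lab t)"
  by (cases s) simp

lemma kids_glue: "fset (kids (glue s t)) = (\<Union>x\<in>fset (kids s). glue x ` fset (kids t))"
  by (cases s) (auto simp: ffUnion.rep_eq)

lemma ty_eqI: "lab s = lab t \<Longrightarrow> fset (kids s) = fset (kids t) \<Longrightarrow> s = t"
  by (cases s, cases t) (simp add: fset_inject)

lemma merge_commute: "merge_atoms (merge_atoms a b) c = merge_atoms (merge_atoms a c) b"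
  by (cases a, cases b, cases c) auto

text \<open>After two copies every set that is nonempty in \<open>b\<close> already has two
  elements, and all intersections and edges were contributed by the first copy.\<close>

lemma merge_stable: "merge_atoms (merge_atoms (merge_atoms a b) b) b = merge_atoms (merge_atoms a b) b"
  by (cases a, cases b) auto

text \<open>Both attachments use the root of \<open>x\<close>, and \<open>merge_atoms\<close> keeps
  the root marks of its first argument only, so no edge arises between the two attached parts and
  their order is invisible.\<close>

lemma glue_commute: "glue (glue x y) z = glue (glue x z) y"
proof (induction x arbitrary: y z)
  case (Node a X)
  show ?case
  proof (rule ty_eqI)
    show "lab (glue (glue (Node a X) y) z) = lab (glue (glue (Node a X) z) y)"
      by (simp add: merge_commute)
    have "glue (glue x y') z' = glue (glue x z') y'" if "x \<in> fset X" for x y' z'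
      using Node that by simp
    then show "fset (kids (glue (glue (Node a X) y) z)) = fset (kids (glue (glue (Node a X) z) y))"
      unfolding kids_glue by (auto simp: image_iff) (metis)+
  qed
qed

section \<open>Saturation under repeated attachment and absorbing types\<close>

definition attach :: "ty \<Rightarrow> ty \<Rightarrow> ty" where
  "attach y x = glue x y"

interpretation attach: comp_fun_commute attach
  by standard (auto simp: attach_def fun_eq_iff glue_commute)

definition saturates :: "nat \<Rightarrow> ty \<Rightarrow> bool" where
  "saturates N y \<longleftrightarrow> (\<forall>x. (attach y ^^ Suc N) x = (attach y ^^ N) x)"

lemma saturates_mono:
  assumes "saturates N y" "N \<le> N'"
  shows "saturates N' y"
  using assms(2,1)
  by (induction N' rule: dec_induct) (simp_all add: saturates_def)

lemma fold_mset_replicate: "fold_mset attach x (replicate_mset n y) = (attach y ^^ n) x"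
  by (induction n) auto

lemma fold_mset_saturated:
  assumes "saturates N y" "N \<le> count M y"
  shows "fold_mset attach x (add_mset y M) = fold_mset attach x M"
proof -
  obtain M' where M: "M = replicate_mset N y + M'"
    using assms(2) by (metis count_le_replicate_mset_subset_eq mset_subset_eq_exists_conv)
  have "fold_mset attach x (add_mset y M) = (attach y ^^ Suc N) (fold_mset attach x M')"
    by (simp add: M fold_mset_replicate flip: attach.fold_mset_fun_left_comm add.commute[of M'])
  also have "\<dots> = (attach y ^^ N) (fold_mset attach x M')"
    using assms(1) by (simp add: saturates_def)
  also have "\<dots> = fold_mset attach x M"
    by (simp add: M fold_mset_replicate flip: add.commute[of M'])
  finally show ?thesis .
qed

text \<open>A set in \<open>x\<close> with \<open>n\<close> attached copies of \<open>y\<close> is a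
  choice of one child for each copy. By commutation only the multiset of these choices matters,
  which prepares the pigeonhole argument.\<close>

lemma kids_attach_power:
  "fset (kids ((attach y ^^ n) x)) =
     {fold_mset attach x' M | x' M. x' \<in> fset (kids x) \<and> size M = n \<and> set_mset M \<subseteq> fset (kids y)}"
proof (induction n)
  case 0
  then show ?case by auto
next
  case (Suc n)
  have "fset (kids ((attach y ^^ Suc n) x)) = {attach y' s | s y'. s \<in> fset (kids ((attach y ^^ n) x)) \<and> y' \<in> fset (kids y)}"
    by (auto simp: attach_def kids_glue)
  also have "\<dots> = {fold_mset attach x' (add_mset y' M) | x' y' M.
      x' \<in> fset (kids x) \<and> size M = n \<and> set_mset M \<subseteq> fset (kids y) \<and> y' \<in> fset (kids y)}"
    unfolding Suc by auto
  also have "\<dots> = {fold_mset attach x' M | x' M.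
      x' \<in> fset (kids x) \<and> size M = Suc n \<and> set_mset M \<subseteq> fset (kids y)}" (is "?A = ?B")
  proof
    show "?A \<subseteq> ?B"
    proof clarify
      fix x' y' M assume "x' \<in> fset (kids x)" "n = size M" "set_mset M \<subseteq> fset (kids y)" "y' \<in> fset (kids y)"
      then show "\<exists>x'' M'. fold_mset attach x' (add_mset y' M) = fold_mset attach x'' M' \<and>
          x'' \<in> fset (kids x) \<and> size M' = Suc (size M) \<and> set_mset M' \<subseteq> fset (kids y)"
        by (intro exI[of _ x'] exI[of _ "add_mset y' M"]) auto
    qed
    show "?B \<subseteq> ?A"
    proof
      fix s assume "s \<in> ?B"
      then obtain x' M where *: "s = fold_mset attach x' M" "x' \<in> fset (kids x)" "size M = Suc n"
        "set_mset M \<subseteq> fset (kids y)" by blast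
      then obtain y' M' where "M = add_mset y' M'" by (metis size_eq_Suc_imp_eq_union)
      with * show "s \<in> ?A" by auto
    qed
  qed
  finally show ?case .
qed

lemma pigeonhole_mset:
  assumes "finite Y" "set_mset M \<subseteq> Y" "card Y * N < size M"
  obtains y where "y \<in> Y" "N < count M y"
proof (rule ccontr)
  assume "\<not> thesis"
  then have "\<And>y. y \<in> Y \<Longrightarrow> count M y \<le> N" using that by force
  then have "sum (count M) Y \<le> card Y * N"
    by (metis mult.commute of_nat_id sum_bounded_above)
  moreover have "size M = sum (count M) Y"
    unfolding size_multiset_overloaded_eq
    by (rule sum.mono_neutral_left) (use assms not_in_iff in \<open>auto simp: not_in_iff\<close>)
  ultimately show False using assms(3) by simp
qed

lemma lab_attach_power: "lab ((attach y ^^ Suc (Suc n)) x) = merge_atoms (merge_atoms (lab x) (lab y)) (lab y)"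
  by (induction n) (simp_all add: attach_def merge_stable)

text \<open>Induction on the tree: with many copies of \<open>y\<close>, every choice of children
  uses some child more often than its own saturation bound, so one occurrence of it can be removed
  or added without effect. The bound has to be uniform in \<open>x\<close> for the induction to go
  through.\<close>

lemma ex_saturates: "\<exists>N. saturates N y"
proof (induction y)
  case (Node b Y)
  then obtain h where h: "\<And>y. y \<in> fset Y \<Longrightarrow> saturates (h y) y" by metis
  define N where "N = Max (insert 0 (h ` fset Y))"
  have N: "saturates N y" if "y \<in> fset Y" for y
    using h[OF that] by (rule saturates_mono) (use that in \<open>simp add: N_def\<close>)
  \<comment> \<open>More than \<open>card (fset Y) * N\<close> copies force a child to occur more
    than \<open>N\<close> times; the two extra copies make the labels stable as well.\<close>
  define n where "n = Suc (Suc (card (fset Y) * N))"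
  have "saturates n (Node b Y)"
    unfolding saturates_def
  proof (intro allI ty_eqI)
    fix x
    show "lab ((attach (Node b Y) ^^ Suc n) x) = lab ((attach (Node b Y) ^^ n) x)"
      by (simp only: n_def lab_attach_power)
    show "fset (kids ((attach (Node b Y) ^^ Suc n) x)) = fset (kids ((attach (Node b Y) ^^ n) x))"
      unfolding kids_attach_power ty.sel
    proof (intro equalityI subsetI; clarify)
      fix x' M assume *: "x' \<in> fset (kids x)" "size M = Suc n" "set_mset M \<subseteq> fset Y"
      then obtain y where y: "y \<in> fset Y" "N < count M y"
        using pigeonhole_mset[of "fset Y" M N] by (auto simp: n_def)
      then obtain M' where M': "M = add_mset y M'"
        by (metis count_inI gr_implies_not0 multi_member_split)
      have "fold_mset attach x' M = fold_mset attach x' M'"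
        unfolding M' by (rule fold_mset_saturated[OF N[OF y(1)]]) (use y(2) M' in simp)
      with * M' show "\<exists>x'' M''. fold_mset attach x' M = fold_mset attach x'' M'' \<and>
          x'' \<in> fset (kids x) \<and> size M'' = n \<and> set_mset M'' \<subseteq> fset Y"
        by auto
    next
      fix x' M assume *: "x' \<in> fset (kids x)" "n = size M" "set_mset M \<subseteq> fset Y"
      then obtain y where y: "y \<in> fset Y" "N < count M y"
        using pigeonhole_mset[of "fset Y" M N] by (auto simp: n_def)
      with N have "fold_mset attach x' M = fold_mset attach x' (add_mset y M)"
        by (metis fold_mset_saturated less_imp_le)
      with * y show "\<exists>x'' M'. fold_mset attach x' M = fold_mset attach x'' M' \<and>
          x'' \<in> fset (kids x) \<and> size M' = Suc (size M) \<and> set_mset M' \<subseteq> fset Y"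
        by (metis insert_subset set_mset_add_mset_insert size_add_mset)
    qed
  qed
  then show ?case ..
qed

text \<open>The types are treated one at a time: attaching \<open>t\<close> to \<open>m\<close>
  until saturation makes \<open>t\<close> absorbed, and by \<open>glue_commute\<close> the types
  absorbed earlier remain so.\<close>

lemma ex_absorbing:
  assumes "finite T" "T \<noteq> {}" and closed: "\<And>s t. s \<in> T \<Longrightarrow> t \<in> T \<Longrightarrow> glue s t \<in> T"
  obtains m where "m \<in> T" "\<And>t. t \<in> T \<Longrightarrow> glue m t = m"
proof -
  have "\<exists>m\<in>T. \<forall>t\<in>U. glue m t = m" if "finite U" "U \<subseteq> T" for U
    using that
  proof (induction U rule: finite_induct)
    case empty
    then show ?case using assms(2) by blast
  next
    case (insert t U)
    then obtain m where m: "m \<in> T" "\<And>u. u \<in> U \<Longrightarrow> glue m u = m" by blast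
    obtain N where N: "saturates N t" using ex_saturates by blast
    define m' where "m' = (attach t ^^ N) m"
    have "(attach t ^^ n) m \<in> T \<and> (\<forall>u\<in>U. glue ((attach t ^^ n) m) u = (attach t ^^ n) m)" for n
      using m insert.prems
      by (induction n) (auto simp: attach_def closed glue_commute[of _ t])
    moreover have "glue m' t = m'"
      using N by (simp add: m'_def saturates_def attach_def)
    ultimately show ?case unfolding m'_def by blast
  qed
  from this[of T] assms(1) that show thesis by blast
qed

text \<open>Parameters are sets throughout, singletons standing for elements. The entries say which \<open>As i\<close>
  have at least two elements, which pairs intersect, which pairs are joined by an edge, and which
  \<open>As i\<close> meet the root set; this is enough to compute the same data for a join. The root is a set so
  that \<open>R = {}\<close> covers unrooted graphs and disjoint unions.\<close>

definition atoms :: "'v graph \<Rightarrow> 'v set \<Rightarrow> (nat \<Rightarrow> 'v set) \<Rightarrow> atom" where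
  "atoms G R As = ({i. \<exists>u\<in>As i. \<exists>v\<in>As i. u \<noteq> v}, {(i, j). As i \<inter> As j \<noteq> {}},
     {(i, j). \<exists>u\<in>As i. \<exists>v\<in>As j. {u, v} \<in> edges G}, {i. R \<inter> As i \<noteq> {}})"

text \<open>A new set is pushed to index 0 as in de Bruijn numbering. The family of parameters is
  total; indices not in use are meant to hold \<open>{}\<close>.\<close>

primrec htype :: "nat \<Rightarrow> 'v graph \<Rightarrow> 'v set \<Rightarrow> (nat \<Rightarrow> 'v set) \<Rightarrow> ty" where
  "htype 0 G R As = Node (atoms G R As) {||}"
| "htype (Suc k) G R As =
     Node (atoms G R As) (Abs_fset ((\<lambda>S. htype k G R (case_nat S As)) ` Pow (verts G)))"

lemma lab_htype [simp]: "lab (htype k G R As) = atoms G R As"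
  by (cases k) auto

lemma kids_htype_Suc:
  assumes "simple_graph G"
  shows "fset (kids (htype (Suc k) G R As)) = (\<lambda>S. htype k G R (case_nat S As)) ` Pow (verts G)"
  using assms by (simp add: Abs_fset_inverse simple_graph_def)

definition graph_join :: "'v graph \<Rightarrow> 'v set \<Rightarrow> 'v graph \<Rightarrow> 'v set \<Rightarrow> 'v graph" where
  "graph_join G R H S = (verts G \<union> verts H, edges G \<union> edges H \<union> {{r, s} | r s. r \<in> R \<and> s \<in> S})"

lemma verts_join [simp]: "verts (graph_join G R H S) = verts G \<union> verts H"
  by (simp add: graph_join_def)

lemma edges_join: "edges (graph_join G R H S) = edges G \<union> edges H \<union> {{r, s} | r s. r \<in> R \<and> s \<in> S}"
  by (simp add: graph_join_def)

lemma simple_edge_verts: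
  assumes "simple_graph G" "{u, v} \<in> edges G"
  shows "u \<in> verts G" "v \<in> verts G" "u \<noteq> v"
proof -
  have "{u, v} \<subseteq> verts G \<and> card {u, v} = 2"
    using bspec[OF conjunct2[OF assms(1)[unfolded simple_graph_def]] assms(2)] .
  then show "u \<in> verts G" "v \<in> verts G" "u \<noteq> v" by auto
qed

lemma simple_join:
  assumes "simple_graph G" "simple_graph H" "verts G \<inter> verts H = {}" "R \<subseteq> verts G" "S \<subseteq> verts H"
  shows "simple_graph (graph_join G R H S)"
proof -
  have "{r, s} \<subseteq> verts G \<union> verts H \<and> card {r, s} = 2" if "r \<in> R" "s \<in> S" for r s
  proof -
    have "r \<in> verts G" "s \<in> verts H" using that assms(4,5) by auto
    moreover from this have "r \<noteq> s" using assms(3) by blast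
    ultimately show ?thesis by simp
  qed
  moreover have "finite (verts G)" "finite (verts H)"
    "\<And>e. e \<in> edges G \<Longrightarrow> e \<subseteq> verts G \<and> card e = 2"
    "\<And>e. e \<in> edges H \<Longrightarrow> e \<subseteq> verts H \<and> card e = 2"
    using assms(1,2) by (simp_all add: simple_graph_def)
  ultimately show ?thesis
    unfolding simple_graph_def verts_join edges_join by fastforce
qed

lemma atoms_join:
  assumes "simple_graph G" "simple_graph H" "verts G \<inter> verts H = {}" "R \<subseteq> verts G" "S \<subseteq> verts H"
    and "\<And>i. As i \<subseteq> verts G" "\<And>i. Bs i \<subseteq> verts H"
  shows "atoms (graph_join G R H S) R (\<lambda>i. As i \<union> Bs i) = merge_atoms (atoms G R As) (atoms H S Bs)"
proof -
  have A: "x \<notin> verts H" if "x \<in> As i" for x i using assms that by blast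
  have B: "x \<notin> verts G" if "x \<in> Bs i" for x i using assms that by blast
  have edge: "{u, v} \<in> edges (graph_join G R H S) \<longleftrightarrow>
      {u, v} \<in> edges G \<or> {u, v} \<in> edges H \<or> u \<in> R \<and> v \<in> S \<or> u \<in> S \<and> v \<in> R" for u v
    by (auto simp: edges_join doubleton_eq_iff)
  have G: "u \<in> As i" if "u \<in> As i \<union> Bs i" "u \<in> verts G" for u i using that B by blast
  have H: "u \<in> Bs i" if "u \<in> As i \<union> Bs i" "u \<in> verts H" for u i using that A by blast
  have 1: "(\<exists>u\<in>As i \<union> Bs i. \<exists>v\<in>As i \<union> Bs i. u \<noteq> v) \<longleftrightarrow>
     (\<exists>u\<in>As i. \<exists>v\<in>As i. u \<noteq> v) \<or> (\<exists>u\<in>Bs i. \<exists>v\<in>Bs i. u \<noteq> v) \<or> As i \<inter> As i \<noteq> {} \<and> Bs i \<inter> Bs i \<noteq> {}" for i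
  proof -
    have "u \<noteq> v" if "u \<in> As i" "v \<in> Bs i" for u v using that A assms(7) by blast
    then show ?thesis unfolding Int_absorb by blast
  qed
  have 2: "(As i \<union> Bs i) \<inter> (As j \<union> Bs j) \<noteq> {} \<longleftrightarrow> As i \<inter> As j \<noteq> {} \<or> Bs i \<inter> Bs j \<noteq> {}" for i j
    using assms(3,6,7) by blast
  have 3: "(\<exists>u\<in>As i \<union> Bs i. \<exists>v\<in>As j \<union> Bs j. {u, v} \<in> edges (graph_join G R H S)) \<longleftrightarrow>
     (\<exists>u\<in>As i. \<exists>v\<in>As j. {u, v} \<in> edges G) \<or> (\<exists>u\<in>Bs i. \<exists>v\<in>Bs j. {u, v} \<in> edges H)
     \<or> R \<inter> As i \<noteq> {} \<and> S \<inter> Bs j \<noteq> {} \<or> S \<inter> Bs i \<noteq> {} \<and> R \<inter> As j \<noteq> {}" (is "?l \<longleftrightarrow> ?r") for i j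
  proof
    assume ?l
    then obtain u v where uv: "u \<in> As i \<union> Bs i" "v \<in> As j \<union> Bs j" "{u, v} \<in> edges (graph_join G R H S)"
      by blast
    then consider "{u, v} \<in> edges G" | "{u, v} \<in> edges H" | "u \<in> R" "v \<in> S" | "u \<in> S" "v \<in> R"
      unfolding edge by blast
    then show ?r
    proof cases
      case 1
      with simple_edge_verts[OF assms(1) 1] uv G show ?thesis by blast
    next
      case 2
      with simple_edge_verts[OF assms(2) 2] uv H show ?thesis by blast
    next
      case 3
      with uv G H assms(4,5) show ?thesis by blast
    next
      case 4
      with uv G H assms(4,5) show ?thesis by blast
    qed
  next
    assume ?r
    then show ?l unfolding edge by blast
  qed
  have 4: "R \<inter> (As i \<union> Bs i) \<noteq> {} \<longleftrightarrow> R \<inter> As i \<noteq> {}" for i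
    using assms(3,4,7) by blast
  show ?thesis
    unfolding atoms_def 1 2 3 4 merge_atoms.simps by auto
qed

text \<open>Subsets of the join correspond to pairs of subsets of the two parts, exactly the pairs
  that \<open>glue\<close> runs through. The parameters of the join are given by their traces on the
  parts.\<close>

lemma htype_join:
  assumes "simple_graph G" "simple_graph H" "verts G \<inter> verts H = {}" "R \<subseteq> verts G" "S \<subseteq> verts H"
    and "\<And>i. As i \<subseteq> verts G" "\<And>i. Bs i \<subseteq> verts H"
  shows "htype k (graph_join G R H S) R (\<lambda>i. As i \<union> Bs i) = glue (htype k G R As) (htype k H S Bs)"
  using assms(6,7)
proof (induction k arbitrary: As Bs)
  case 0
  show ?case
    by (rule ty_eqI) (simp_all add: atoms_join assms(1-5) 0 kids_glue del: glue.simps)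
next
  case (Suc k)
  have IH: "htype k (graph_join G R H S) R (case_nat (X \<union> Y) (\<lambda>i. As i \<union> Bs i)) =
      glue (htype k G R (case_nat X As)) (htype k H S (case_nat Y Bs))"
    if "X \<subseteq> verts G" "Y \<subseteq> verts H" for X Y
  proof -
    have "case_nat (X \<union> Y) (\<lambda>i. As i \<union> Bs i) = (\<lambda>i. case_nat X As i \<union> case_nat Y Bs i)"
      by (auto simp: fun_eq_iff split: nat.split)
    moreover have "case_nat X As i \<subseteq> verts G" "case_nat Y Bs i \<subseteq> verts H" for i
      using Suc.prems that by (auto split: nat.split)
    ultimately show ?thesis using Suc.IH[of "case_nat X As" "case_nat Y Bs"] by simp
  qed
  have P: "Pow (verts G \<union> verts H) = {X \<union> Y | X Y. X \<subseteq> verts G \<and> Y \<subseteq> verts H}"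
  proof (intro equalityI subsetI)
    fix U assume "U \<in> Pow (verts G \<union> verts H)"
    then have "U = (U \<inter> verts G) \<union> (U \<inter> verts H)" by blast
    then show "U \<in> {X \<union> Y | X Y. X \<subseteq> verts G \<and> Y \<subseteq> verts H}" by blast
  qed blast
  show ?case
  proof (rule ty_eqI)
    show "lab (htype (Suc k) (graph_join G R H S) R (\<lambda>i. As i \<union> Bs i)) =
        lab (glue (htype (Suc k) G R As) (htype (Suc k) H S Bs))"
      using atoms_join[OF assms(1-5) Suc.prems] by simp
    show "fset (kids (htype (Suc k) (graph_join G R H S) R (\<lambda>i. As i \<union> Bs i))) =
        fset (kids (glue (htype (Suc k) G R As) (htype (Suc k) H S Bs)))"
      unfolding kids_glue kids_htype_Suc[OF simple_join[OF assms(1-5)]] kids_htype_Suc[OF assms(1)]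
        kids_htype_Suc[OF assms(2)] verts_join P
    proof (intro equalityI subsetI)
      fix t assume "t \<in> (\<lambda>U. htype k (graph_join G R H S) R (case_nat U (\<lambda>i. As i \<union> Bs i))) `
          {X \<union> Y | X Y. X \<subseteq> verts G \<and> Y \<subseteq> verts H}"
      then obtain X Y where "X \<subseteq> verts G" "Y \<subseteq> verts H"
        "t = glue (htype k G R (case_nat X As)) (htype k H S (case_nat Y Bs))"
        using IH by auto
      then show "t \<in> (\<Union>x\<in>(\<lambda>U. htype k G R (case_nat U As)) ` Pow (verts G).
          glue x ` (\<lambda>U. htype k H S (case_nat U Bs)) ` Pow (verts H))" by blast
    next
      fix t assume "t \<in> (\<Union>x\<in>(\<lambda>U. htype k G R (case_nat U As)) ` Pow (verts G).
          glue x ` (\<lambda>U. htype k H S (case_nat U Bs)) ` Pow (verts H))"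
      then obtain X Y where "X \<subseteq> verts G" "Y \<subseteq> verts H"
        "t = glue (htype k G R (case_nat X As)) (htype k H S (case_nat Y Bs))" by auto
      then show "t \<in> (\<lambda>U. htype k (graph_join G R H S) R (case_nat U (\<lambda>i. As i \<union> Bs i))) `
          {X \<union> Y | X Y. X \<subseteq> verts G \<and> Y \<subseteq> verts H}"
        using IH[of X Y] by (intro image_eqI[where x="X \<union> Y"]) auto
    qed
  qed
qed

section \<open>Relabelling, change of root and finiteness of the set of types\<close>

definition relabel :: "('v \<Rightarrow> 'w) \<Rightarrow> 'v graph \<Rightarrow> 'w graph" where
  "relabel f G = (f ` verts G, (`) f ` edges G)"

lemma verts_relabel [simp]: "verts (relabel f G) = f ` verts G"
  by (simp add: relabel_def)

lemma edges_relabel: "edges (relabel f G) = (`) f ` edges G"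
  by (simp add: relabel_def)

lemma simple_relabel:
  assumes "simple_graph G" "inj_on f (verts G)"
  shows "simple_graph (relabel f G)"
  using assms unfolding simple_graph_def relabel_def
  by (auto simp: card_image inj_on_subset)

lemma edge_relabel_iff:
  assumes "simple_graph G" "inj_on f (verts G)" "u \<in> verts G" "v \<in> verts G"
  shows "{f u, f v} \<in> edges (relabel f G) \<longleftrightarrow> {u, v} \<in> edges G"
proof -
  have "inj_on ((`) f) (Pow (verts G))" using assms(2) by (rule inj_on_image_Pow)
  moreover have "edges G \<subseteq> Pow (verts G)" "{u, v} \<in> Pow (verts G)"
    using assms unfolding simple_graph_def by auto
  ultimately have "f ` {u, v} \<in> (`) f ` edges G \<longleftrightarrow> {u, v} \<in> edges G"
    by (meson inj_on_image_mem_iff)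
  then show ?thesis by (simp add: edges_relabel)
qed

lemma graph_iso_relabel:
  assumes "simple_graph G" "inj_on f (verts G)"
  shows "graph_iso G (relabel f G)"
  unfolding graph_iso_def
  using assms edge_relabel_iff[OF assms] by (intro exI[of _ f]) (auto simp: bij_betw_def)

lemma htype_relabel:
  assumes "simple_graph G" "inj_on f (verts G)" "R \<subseteq> verts G" "\<And>i. As i \<subseteq> verts G"
  shows "htype k (relabel f G) (f ` R) (\<lambda>i. f ` As i) = htype k G R As"
  using assms(4)
proof (induction k arbitrary: As)
  have at: "atoms (relabel f G) (f ` R) (\<lambda>i. f ` As i) = atoms G R As"
    if As: "\<And>i. As i \<subseteq> verts G" for As
  proof -
    have eq: "f u = f v \<longleftrightarrow> u = v" if "u \<in> As i \<union> R" "v \<in> As j \<union> R" for u v i j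
      using that As assms(3) inj_on_eq_iff[OF assms(2)] by blast
    have ed: "{f u, f v} \<in> edges (relabel f G) \<longleftrightarrow> {u, v} \<in> edges G" if "u \<in> As i" "v \<in> As j" for u v i j
      using that As edge_relabel_iff[OF assms(1,2)] by blast
    have int: "f ` X \<inter> f ` Y \<noteq> {} \<longleftrightarrow> X \<inter> Y \<noteq> {}" if "X \<subseteq> verts G" "Y \<subseteq> verts G" for X Y
      using inj_on_image_Int[OF assms(2) that] by auto
    have "(\<exists>u\<in>f ` As i. \<exists>v\<in>f ` As i. u \<noteq> v) \<longleftrightarrow> (\<exists>u\<in>As i. \<exists>v\<in>As i. u \<noteq> v)" for i
      using eq by (simp add: Bex_def) blast
    moreover have "(\<exists>u\<in>f ` As i. \<exists>v\<in>f ` As j. {u, v} \<in> edges (relabel f G)) \<longleftrightarrow>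
        (\<exists>u\<in>As i. \<exists>v\<in>As j. {u, v} \<in> edges G)" for i j
      using ed by (simp add: Bex_def) blast
    ultimately show ?thesis
      unfolding atoms_def int[OF As As] int[OF assms(3) As] by simp
  qed
  {
    case 0
    then show ?case using at by simp
  next
    case (Suc k)
    have "htype k (relabel f G) (f ` R) (case_nat (f ` X) (\<lambda>i. f ` As i)) = htype k G R (case_nat X As)"
      if "X \<subseteq> verts G" for X
    proof -
      have "case_nat (f ` X) (\<lambda>i. f ` As i) = (\<lambda>i. f ` case_nat X As i)"
        by (auto simp: fun_eq_iff split: nat.split)
      moreover have "case_nat X As i \<subseteq> verts G" for i
        using Suc.prems that by (auto split: nat.split)
      ultimately show ?thesis using Suc.IH[of "case_nat X As"] by simp
    qed
    moreover have "Pow (f ` verts G) = (`) f ` Pow (verts G)"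
      by (simp add: image_Pow_surj)
    ultimately show ?case using at[OF Suc.prems]
      by (simp add: image_image)
  }
qed

text \<open>Makes a change of root possible: a rooted type determines the unrooted one, so the types
  of one graph at two different roots can be compared.\<close>

primrec forget :: "ty \<Rightarrow> ty" where
  "forget (Node a X) = Node (case a of (B, I, E, R) \<Rightarrow> (B, I, E, {})) (forget |`| X)"

lemma lab_forget: "lab (forget t) = (case lab t of (B, I, E, R) \<Rightarrow> (B, I, E, {}))"
  by (cases t) auto

lemma kids_forget: "fset (kids (forget t)) = forget ` fset (kids t)"
  by (cases t) auto

lemma forget_htype:
  assumes "simple_graph G"
  shows "forget (htype k G R As) = htype k G {} As"
proof (induction k arbitrary: As)
  case 0
  show ?case by (simp add: atoms_def)
next
  case (Suc k)
  show ?case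
    by (rule ty_eqI)
      (simp_all add: lab_forget kids_forget kids_htype_Suc assms image_image Suc atoms_def del: htype.simps)
qed

text \<open>Each level brings in one more parameter, so the bound \<open>m\<close> on the indices in
  use grows along the induction. The root set may be arbitrary because only its traces on the
  parameters enter the labels.\<close>

lemma finite_types:
  "finite {htype k G R As | (G :: 'v graph) R (As :: nat \<Rightarrow> 'v set). simple_graph G \<and> (\<forall>i\<ge>m. As i = {})}"
    (is "finite (?T k m)")
proof (induction k arbitrary: m)
  have at: "atoms G R As \<in> Pow {..<m} \<times> Pow ({..<m} \<times> {..<m}) \<times> Pow ({..<m} \<times> {..<m}) \<times> Pow {..<m}"
    (is "_ \<in> ?A m") if "\<forall>i\<ge>m. As i = {}" for G :: "'v graph" and R and As :: "nat \<Rightarrow> 'v set" and m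
  proof -
    have "i < m" if "x \<in> As i" for x i using that \<open>\<forall>i\<ge>m. As i = {}\<close> by (metis empty_iff not_less)
    then show ?thesis by (auto simp: atoms_def)
  qed
  have fin: "finite (?A m)" for m by auto
  {
    case 0
    have "?T 0 m \<subseteq> (\<lambda>a. Node a {||}) ` ?A m" using at by auto
    then show ?case by (rule finite_surj[OF fin])
  next
    case (Suc k)
    have "?T (Suc k) m \<subseteq> (\<lambda>(a, X). Node a (Abs_fset X)) ` (?A m \<times> Pow (?T k (Suc m)))"
    proof clarify
      fix G :: "'v graph" and R and As :: "nat \<Rightarrow> 'v set" assume *: "simple_graph G" "\<forall>i\<ge>m. As i = {}"
      let ?X = "(\<lambda>S. htype k G R (case_nat S As)) ` Pow (verts G)"
      have "\<forall>i\<ge>Suc m. case_nat S As i = {}" for S using *(2) by (auto split: nat.split)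
      then have "?X \<subseteq> ?T k (Suc m)" using *(1) by blast
      with at[OF *(2), of G R]
      show "htype (Suc k) G R As \<in> (\<lambda>(a, X). Node a (Abs_fset X)) ` (?A m \<times> Pow (?T k (Suc m)))"
        by (intro image_eqI[where x="(atoms G R As, ?X)"]) auto
    qed
    moreover have "finite (?A m \<times> Pow (?T k (Suc m)))"
      using fin[of m] Suc[of "Suc m"] by (simp only: finite_cartesian_product finite_Pow_iff)
    ultimately show ?case by (rule finite_surj[rotated])
  }
qed

section \<open>Types decide MSO sentences\<close>

primrec qrank :: "mso \<Rightarrow> nat" where
  "qrank (Mem x X) = 0"
| "qrank (Edge x y) = 0"
| "qrank (Neg \<phi>) = qrank \<phi>"
| "qrank (Conj \<phi> \<psi>) = max (qrank \<phi>) (qrank \<psi>)"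
| "qrank (Disj \<phi> \<psi>) = max (qrank \<phi>) (qrank \<psi>)"
| "qrank (ExV x \<phi>) = Suc (qrank \<phi>)"
| "qrank (AllV x \<phi>) = Suc (qrank \<phi>)"
| "qrank (ExS X \<phi>) = Suc (qrank \<phi>)"
| "qrank (AllS X \<phi>) = Suc (qrank \<phi>)"

text \<open>\<open>p\<close> and \<open>q\<close> give the index at which an element or set variable
  is currently stored, elements as singletons. A quantifier shifts all indices by \<open>Suc\<close>
  and stores its own variable at 0.\<close>

definition represents where
  "represents p q \<phi> a A As \<longleftrightarrow>
     (\<forall>x\<in>free_vars \<phi>. As (p x) = {a x}) \<and> (\<forall>X\<in>free_set_vars \<phi>. As (q X) = A X)"

lemma atoms_eqD:
  assumes "atoms G R As = atoms H S Bs"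
  shows "(\<exists>u\<in>As i. \<exists>v\<in>As i. u \<noteq> v) \<longleftrightarrow> (\<exists>u\<in>Bs i. \<exists>v\<in>Bs i. u \<noteq> v)"
    and "As i \<inter> As j \<noteq> {} \<longleftrightarrow> Bs i \<inter> Bs j \<noteq> {}"
    and "(\<exists>u\<in>As i. \<exists>v\<in>As j. {u, v} \<in> edges G) \<longleftrightarrow> (\<exists>u\<in>Bs i. \<exists>v\<in>Bs j. {u, v} \<in> edges H)"
proof -
  have eqs: "{i. \<exists>u\<in>As i. \<exists>v\<in>As i. u \<noteq> v} = {i. \<exists>u\<in>Bs i. \<exists>v\<in>Bs i. u \<noteq> v}"
    "{(i, j). As i \<inter> As j \<noteq> {}} = {(i, j). Bs i \<inter> Bs j \<noteq> {}}"
    "{(i, j). \<exists>u\<in>As i. \<exists>v\<in>As j. {u, v} \<in> edges G} = {(i, j). \<exists>u\<in>Bs i. \<exists>v\<in>Bs j. {u, v} \<in> edges H}"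
    using assms unfolding atoms_def prod.inject by - (elim conjE, assumption)+
  show "(\<exists>u\<in>As i. \<exists>v\<in>As i. u \<noteq> v) \<longleftrightarrow> (\<exists>u\<in>Bs i. \<exists>v\<in>Bs i. u \<noteq> v)"
    using eqset_imp_iff[OF eqs(1), of i] unfolding mem_Collect_eq .
  show "As i \<inter> As j \<noteq> {} \<longleftrightarrow> Bs i \<inter> Bs j \<noteq> {}"
    using eqset_imp_iff[OF eqs(2), of "(i, j)"] unfolding mem_Collect_eq prod.case .
  show "(\<exists>u\<in>As i. \<exists>v\<in>As j. {u, v} \<in> edges G) \<longleftrightarrow> (\<exists>u\<in>Bs i. \<exists>v\<in>Bs j. {u, v} \<in> edges H)"
    using eqset_imp_iff[OF eqs(3), of "(i, j)"] unfolding mem_Collect_eq prod.case .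
qed

lemma htype_Suc_D:
  assumes "htype (Suc k) G R As = htype (Suc k) H S Bs" "simple_graph G" "simple_graph H" "X \<subseteq> verts G"
  obtains Y where "Y \<subseteq> verts H" "htype k G R (case_nat X As) = htype k H S (case_nat Y Bs)"
proof -
  have "htype k G R (case_nat X As) \<in> fset (kids (htype (Suc k) G R As))"
    unfolding kids_htype_Suc[OF assms(2)] using assms(4) by blast
  then have "htype k G R (case_nat X As) \<in> fset (kids (htype (Suc k) H S Bs))"
    unfolding assms(1) .
  then show thesis
    unfolding kids_htype_Suc[OF assms(3)] using that by blast
qed

text \<open>The label recognises singletons, as nonempty sets without two different elements, so an
  element move is answered by an element although the tree offers only sets.\<close>

lemma htype_Suc_D1:
  assumes "htype (Suc k) G R As = htype (Suc k) H S Bs" "simple_graph G" "simple_graph H" "u \<in> verts G"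
  obtains v where "v \<in> verts H" "htype k G R (case_nat {u} As) = htype k H S (case_nat {v} Bs)"
proof -
  obtain Y where Y: "Y \<subseteq> verts H" "htype k G R (case_nat {u} As) = htype k H S (case_nat Y Bs)"
    using htype_Suc_D[OF assms(1-3), of "{u}"] assms(4) by auto
  have eq: "atoms G R (case_nat {u} As) = atoms H S (case_nat Y Bs)"
    using arg_cong[OF Y(2), of lab] by simp
  have "\<not> (\<exists>v\<in>Y. \<exists>w\<in>Y. v \<noteq> w)" "Y \<noteq> {}"
    using atoms_eqD(1)[OF eq, of 0] atoms_eqD(2)[OF eq, of 0 0] by simp_all
  then obtain v where "Y = {v}" by blast
  with Y that show thesis by auto
qed

lemma back_and_forth:
  assumes "\<And>u. A u \<Longrightarrow> \<exists>v. B v \<and> P u = Q v" "\<And>v. B v \<Longrightarrow> \<exists>u. A u \<and> P u = Q v"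
  shows "(\<exists>u. A u \<and> P u) \<longleftrightarrow> (\<exists>v. B v \<and> Q v)" "(\<forall>u. A u \<longrightarrow> P u) \<longleftrightarrow> (\<forall>v. B v \<longrightarrow> Q v)"
  using assms by metis+

text \<open>The Ehrenfeucht-Fraisse argument: a choice in one graph is a child of the common type,
  hence is also realised by a choice in the other graph. One level of the tree is spent on each
  nested quantifier.\<close>

lemma sat_htype:
  assumes "simple_graph G" "simple_graph H"
    and "htype k G R As = htype k H S Bs" "qrank \<phi> \<le> k"
    and "represents p q \<phi> a A As" "represents p q \<phi> b B Bs"
  shows "sat G a A \<phi> \<longleftrightarrow> sat H b B \<phi>"
  using assms(3-6)
proof (induction \<phi> arbitrary: k As Bs p q a A b B)
  case (Mem x X)
  have "atoms G R As = atoms H S Bs" using arg_cong[OF Mem(1), of lab] by simp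
  from atoms_eqD(2)[OF this, of "p x" "q X"] show ?case
    using Mem(3,4) by (simp add: represents_def)
next
  case (Edge x y)
  have "atoms G R As = atoms H S Bs" using arg_cong[OF Edge(1), of lab] by simp
  from atoms_eqD(3)[OF this, of "p x" "p y"] show ?case
    using Edge(3,4) by (simp add: represents_def)
next
  case (Neg \<phi>)
  have "sat G a A \<phi> = sat H b B \<phi>"
    by (rule Neg.IH[of k As Bs p q]) (use Neg.prems in \<open>simp_all add: represents_def\<close>)
  then show ?case by simp
next
  case (Conj \<phi> \<psi>)
  have "sat G a A \<phi> = sat H b B \<phi>" "sat G a A \<psi> = sat H b B \<psi>"
    by (rule Conj.IH[of k As Bs p q]; use Conj.prems in \<open>simp add: represents_def\<close>)+
  then show ?case by simp
next
  case (Disj \<phi> \<psi>)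
  have "sat G a A \<phi> = sat H b B \<phi>" "sat G a A \<psi> = sat H b B \<psi>"
    by (rule Disj.IH[of k As Bs p q]; use Disj.prems in \<open>simp add: represents_def\<close>)+
  then show ?case by simp
next
  case (ExV x \<phi>)
  then obtain k' where k: "k = Suc k'" "qrank \<phi> \<le> k'" by (cases k) auto
  have step: "sat G (a(x := u)) A \<phi> = sat H (b(x := v)) B \<phi>"
    if "htype k' G R (case_nat {u} As) = htype k' H S (case_nat {v} Bs)" for u v
    by (rule ExV.IH[OF that k(2), of "(Suc \<circ> p)(x := 0)" "Suc \<circ> q"])
      (use ExV.prems in \<open>auto simp: represents_def\<close>)
  have "\<exists>v. v \<in> verts H \<and> sat G (a(x := u)) A \<phi> = sat H (b(x := v)) B \<phi>" if "u \<in> verts G" for u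
    using htype_Suc_D1[OF ExV.prems(1)[unfolded k(1)] assms(1,2) that] step by metis
  moreover have "\<exists>u. u \<in> verts G \<and> sat G (a(x := u)) A \<phi> = sat H (b(x := v)) B \<phi>" if "v \<in> verts H" for v
    using htype_Suc_D1[OF ExV.prems(1)[unfolded k(1), symmetric] assms(2,1) that] step by metis
  ultimately show ?case
    unfolding sat.simps Bex_def Ball_def by (rule back_and_forth)
next
  case (AllV x \<phi>)
  then obtain k' where k: "k = Suc k'" "qrank \<phi> \<le> k'" by (cases k) auto
  have step: "sat G (a(x := u)) A \<phi> = sat H (b(x := v)) B \<phi>"
    if "htype k' G R (case_nat {u} As) = htype k' H S (case_nat {v} Bs)" for u v
    by (rule AllV.IH[OF that k(2), of "(Suc \<circ> p)(x := 0)" "Suc \<circ> q"])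
      (use AllV.prems in \<open>auto simp: represents_def\<close>)
  have "\<exists>v. v \<in> verts H \<and> sat G (a(x := u)) A \<phi> = sat H (b(x := v)) B \<phi>" if "u \<in> verts G" for u
    using htype_Suc_D1[OF AllV.prems(1)[unfolded k(1)] assms(1,2) that] step by metis
  moreover have "\<exists>u. u \<in> verts G \<and> sat G (a(x := u)) A \<phi> = sat H (b(x := v)) B \<phi>" if "v \<in> verts H" for v
    using htype_Suc_D1[OF AllV.prems(1)[unfolded k(1), symmetric] assms(2,1) that] step by metis
  ultimately show ?case
    unfolding sat.simps Bex_def Ball_def by (rule back_and_forth)
next
  case (ExS X \<phi>)
  then obtain k' where k: "k = Suc k'" "qrank \<phi> \<le> k'" by (cases k) auto
  have step: "sat G a (A(X := U)) \<phi> = sat H b (B(X := V)) \<phi>"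
    if "htype k' G R (case_nat U As) = htype k' H S (case_nat V Bs)" for U V
    by (rule ExS.IH[OF that k(2), of "Suc \<circ> p" "(Suc \<circ> q)(X := 0)"])
      (use ExS.prems in \<open>auto simp: represents_def\<close>)
  have "\<exists>V. V \<subseteq> verts H \<and> sat G a (A(X := U)) \<phi> = sat H b (B(X := V)) \<phi>" if "U \<subseteq> verts G" for U
    using htype_Suc_D[OF ExS.prems(1)[unfolded k(1)] assms(1,2) that] step by metis
  moreover have "\<exists>U. U \<subseteq> verts G \<and> sat G a (A(X := U)) \<phi> = sat H b (B(X := V)) \<phi>" if "V \<subseteq> verts H" for V
    using htype_Suc_D[OF ExS.prems(1)[unfolded k(1), symmetric] assms(2,1) that] step by metis
  ultimately show ?case
    unfolding sat.simps by (rule back_and_forth)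
next
  case (AllS X \<phi>)
  then obtain k' where k: "k = Suc k'" "qrank \<phi> \<le> k'" by (cases k) auto
  have step: "sat G a (A(X := U)) \<phi> = sat H b (B(X := V)) \<phi>"
    if "htype k' G R (case_nat U As) = htype k' H S (case_nat V Bs)" for U V
    by (rule AllS.IH[OF that k(2), of "Suc \<circ> p" "(Suc \<circ> q)(X := 0)"])
      (use AllS.prems in \<open>auto simp: represents_def\<close>)
  have "\<exists>V. V \<subseteq> verts H \<and> sat G a (A(X := U)) \<phi> = sat H b (B(X := V)) \<phi>" if "U \<subseteq> verts G" for U
    using htype_Suc_D[OF AllS.prems(1)[unfolded k(1)] assms(1,2) that] step by metis
  moreover have "\<exists>U. U \<subseteq> verts G \<and> sat G a (A(X := U)) \<phi> = sat H b (B(X := V)) \<phi>" if "V \<subseteq> verts H" for V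
    using htype_Suc_D[OF AllS.prems(1)[unfolded k(1), symmetric] assms(2,1) that] step by metis
  ultimately show ?case
    unfolding sat.simps by (rule back_and_forth)
qed

definition utyp :: "nat \<Rightarrow> 'v graph \<Rightarrow> ty" where
  "utyp k G = htype k G {} (\<lambda>_. {})"

lemma models_utyp:
  assumes "simple_graph G" "simple_graph H" "mso_sentence \<phi>" "utyp (qrank \<phi>) G = utyp (qrank \<phi>) H"
  shows "models G \<phi> \<longleftrightarrow> models H \<phi>"
  using assms unfolding models_sentence_iff[OF assms(3), of _ undefined undefined] utyp_def
  by (intro sat_htype[where p = id and q = id]) (auto simp: represents_def mso_sentence_def)

lemma utyp_relabel:
  assumes "simple_graph G" "inj_on f (verts G)"
  shows "utyp k (relabel f G) = utyp k G"
  using htype_relabel[OF assms, of "{}" "\<lambda>_. {}"] by (simp add: utyp_def)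

lemma utyp_join:
  assumes "simple_graph G" "simple_graph H" "verts G \<inter> verts H = {}"
  shows "utyp k (graph_join G {} H {}) = glue (utyp k G) (utyp k H)"
  using htype_join[OF assms, of "{}" "{}" "\<lambda>_. {}" "\<lambda>_. {}"] by (simp add: utyp_def)

section \<open>Closed vertex sets, components and relabelling\<close>

text \<open>For \<open>S \<subseteq> verts G\<close> these are the unions of components. They are
  easier to handle than single components, being stable under complements, and a graph splits along
  them into two induced parts.\<close>

definition closed_in :: "'v graph \<Rightarrow> 'v set \<Rightarrow> bool" where
  "closed_in G S \<longleftrightarrow> (\<forall>u v. {u, v} \<in> edges G \<longrightarrow> u \<in> S \<longrightarrow> v \<in> S)"

definition cls :: "'v graph \<Rightarrow> 'v \<Rightarrow> 'v set" where
  "cls G u = {v \<in> verts G. (u, v) \<in> (adj G)\<^sup>*}"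

lemma closed_in_rtrancl:
  assumes "closed_in G S" "u \<in> S" "(u, v) \<in> (adj G)\<^sup>*"
  shows "v \<in> S"
  using assms(3) by (induction rule: rtrancl_induct) (use assms in \<open>auto simp: closed_in_def adj_def\<close>)

lemma rtrancl_adj_sym: "(u, v) \<in> (adj G)\<^sup>* \<Longrightarrow> (v, u) \<in> (adj G)\<^sup>*"
  by (rule symD[OF sym_rtrancl]) (auto simp: sym_def adj_def insert_commute)

lemma closed_in_cls:
  assumes "simple_graph G"
  shows "closed_in G (cls G u)"
  unfolding closed_in_def cls_def
  using simple_edge_verts[OF assms] by (auto simp: adj_def intro: rtrancl_into_rtrancl)

lemma closed_in_Diff:
  assumes "simple_graph G" "closed_in G S"
  shows "closed_in G (verts G - S)"
  unfolding closed_in_def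
proof (intro allI impI)
  fix u v assume *: "{u, v} \<in> edges G" "u \<in> verts G - S"
  then have "v \<in> verts G" using simple_edge_verts[OF assms(1)] by blast
  moreover have "v \<notin> S" using * assms(2) by (auto simp: closed_in_def insert_commute)
  ultimately show "v \<in> verts G - S" by simp
qed

lemma cls_self: "u \<in> verts G \<Longrightarrow> u \<in> cls G u"
  by (simp add: cls_def)

lemma cls_subset: "cls G u \<subseteq> verts G"
  by (auto simp: cls_def)

lemma cls_eqI: "(u, v) \<in> (adj G)\<^sup>* \<Longrightarrow> cls G u = cls G v"
  unfolding cls_def by (auto intro: rtrancl_trans rtrancl_adj_sym)

lemma verts_induced [simp]: "verts (induced G S) = S"
  by (simp add: induced_def)

lemma edges_induced [simp]: "edges (induced G S) = {e \<in> edges G. e \<subseteq> S}"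
  by (simp add: induced_def)

lemma simple_induced:
  assumes "simple_graph G" "S \<subseteq> verts G"
  shows "simple_graph (induced G S)"
  using assms by (auto simp: simple_graph_def intro: finite_subset)

lemma induced_induced: "T \<subseteq> S \<Longrightarrow> induced (induced G S) T = induced G T"
  by (auto simp: induced_def)

lemma component_eq_induced: "component G u = induced G (cls G u)"
  by (simp add: component_def cls_def)

lemma rtrancl_adj_induced:
  assumes "closed_in G S" "u \<in> S"
  shows "(u, v) \<in> (adj (induced G S))\<^sup>* \<longleftrightarrow> (u, v) \<in> (adj G)\<^sup>*"
proof
  have "adj (induced G S) \<subseteq> adj G" by (auto simp: adj_def)
  then show "(u, v) \<in> (adj (induced G S))\<^sup>* \<Longrightarrow> (u, v) \<in> (adj G)\<^sup>*"
    using rtrancl_mono by blast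
  show "(u, v) \<in> (adj G)\<^sup>* \<Longrightarrow> (u, v) \<in> (adj (induced G S))\<^sup>*"
  proof (induction rule: rtrancl_induct)
    case base
    show ?case by simp
  next
    case (step y z)
    have y: "y \<in> S" using closed_in_rtrancl[OF assms step(1)] .
    moreover have "z \<in> S" using assms(1) step(2) y by (auto simp: closed_in_def adj_def)
    ultimately have "(y, z) \<in> adj (induced G S)" using step(2) by (auto simp: adj_def)
    with step(3) show ?case by (rule rtrancl_into_rtrancl)
  qed
qed

lemma cls_induced:
  assumes "S \<subseteq> verts G" "closed_in G S" "u \<in> S"
  shows "cls (induced G S) u = cls G u"
  using assms closed_in_rtrancl[OF assms(2,3)]
  by (auto simp: cls_def rtrancl_adj_induced)

lemma component_induced:
  assumes "S \<subseteq> verts G" "closed_in G S" "u \<in> S"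
  shows "component (induced G S) u = component G u"
proof -
  have "cls G u \<subseteq> S" using closed_in_rtrancl[OF assms(2,3)] by (auto simp: cls_def)
  then show ?thesis
    by (simp add: component_eq_induced cls_induced[OF assms] induced_induced)
qed

lemma components_split:
  assumes "simple_graph G" "S \<subseteq> verts G" "closed_in G S"
  shows "components G = components (induced G S) \<union> components (induced G (verts G - S))"
proof -
  have "component (induced G S) ` S = component G ` S"
    using component_induced[OF assms(2,3)] by (rule image_cong[OF refl])
  moreover have "component (induced G (verts G - S)) ` (verts G - S) = component G ` (verts G - S)"
    using component_induced[OF Diff_subset closed_in_Diff[OF assms(1,3)]] by (rule image_cong[OF refl])
  ultimately show ?thesis
    using assms(2) by (simp add: components_def image_Un[symmetric] Un_absorb1)
qed

lemma connected_closed: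
  assumes "graph_connected G" "closed_in G X" "X \<inter> verts G \<noteq> {}"
  shows "verts G \<subseteq> X"
proof
  fix v assume "v \<in> verts G"
  moreover obtain u where "u \<in> X" "u \<in> verts G" using assms(3) by blast
  ultimately have "(u, v) \<in> (adj G)\<^sup>*" using assms(1) by (simp add: graph_connected_def)
  with assms(2) \<open>u \<in> X\<close> show "v \<in> X" by (rule closed_in_rtrancl)
qed

text \<open>A description of connectedness without paths, which reduces its invariance under
  relabelling to that of closed sets.\<close>

lemma connected_iff_closed:
  assumes "simple_graph G"
  shows "graph_connected G \<longleftrightarrow>
    verts G \<noteq> {} \<and> (\<forall>X\<subseteq>verts G. closed_in G X \<longrightarrow> X \<noteq> {} \<longrightarrow> X = verts G)" (is "?l \<longleftrightarrow> ?r")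
proof
  assume ?l
  then have "verts G \<noteq> {}" by (simp add: graph_connected_def)
  moreover have "X = verts G" if "X \<subseteq> verts G" "closed_in G X" "X \<noteq> {}" for X
    using connected_closed[OF \<open>?l\<close> that(2)] that(1,3) by (simp add: Int_absorb2 subset_antisym)
  ultimately show ?r by blast
next
  assume r: ?r
  have "(u, v) \<in> (adj G)\<^sup>*" if "u \<in> verts G" "v \<in> verts G" for u v
  proof -
    have "cls G u = verts G"
      using r closed_in_cls[OF assms, of u] cls_self[OF that(1)] cls_subset[of G u] by blast
    then show ?thesis using that(2) by (auto simp: cls_def)
  qed
  with r show ?l by (auto simp: graph_connected_def)
qed

lemma connected_induced_cls:
  assumes "simple_graph G" "u \<in> verts G"
  shows "graph_connected (induced G (cls G u))"
  unfolding graph_connected_def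
proof (intro conjI ballI)
  show "verts (induced G (cls G u)) \<noteq> {}" using cls_self[OF assms(2)] by auto
  fix v w assume "v \<in> verts (induced G (cls G u))" "w \<in> verts (induced G (cls G u))"
  then have vw: "v \<in> cls G u" "w \<in> cls G u" by simp_all
  then have "(v, w) \<in> (adj G)\<^sup>*"
    by (auto simp: cls_def intro: rtrancl_trans rtrancl_adj_sym)
  with vw show "(v, w) \<in> (adj (induced G (cls G u)))\<^sup>*"
    by (simp add: rtrancl_adj_induced[OF closed_in_cls[OF assms(1)]])
qed

lemma simple_edgesD:
  assumes "simple_graph G" "e \<in> edges G"
  obtains u v where "e = {u, v}" "u \<in> verts G" "v \<in> verts G" "u \<noteq> v"
proof -
  have e: "e \<subseteq> verts G" "card e = 2"
    using bspec[OF conjunct2[OF assms(1)[unfolded simple_graph_def]] assms(2)] by simp_all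
  then obtain u v where "e = {u, v}" "u \<noteq> v" unfolding card_2_iff by blast
  with that e(1) show thesis by simp
qed

lemma induced_join:
  assumes "simple_graph G" "simple_graph H" "verts G \<inter> verts H = {}" "R \<subseteq> verts G" "S \<subseteq> verts H"
  shows "induced (graph_join G R H S) (verts G) = G" "induced (graph_join G R H S) (verts H) = H"
proof -
  have G: "e \<subseteq> verts G" "\<not> e \<subseteq> verts H" if "e \<in> edges G" for e
    by (rule simple_edgesD[OF assms(1) that]; use assms(3) in blast)+
  have H: "e \<subseteq> verts H" "\<not> e \<subseteq> verts G" if "e \<in> edges H" for e
    by (rule simple_edgesD[OF assms(2) that]; use assms(3) in blast)+
  have RS: "\<not> {r, s} \<subseteq> verts G" "\<not> {r, s} \<subseteq> verts H" if "r \<in> R" "s \<in> S" for r s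
    using that assms(3-5) by blast+
  show "induced (graph_join G R H S) (verts G) = G"
    by (rule prod_eqI) (use G RS H in \<open>auto simp: edges_join simp del: insert_subset intro: subsetD[OF G(1)]\<close>)
  show "induced (graph_join G R H S) (verts H) = H"
    by (rule prod_eqI) (use G RS H in \<open>auto simp: edges_join simp del: insert_subset intro: subsetD[OF H(1)]\<close>)
qed

lemma join_induced:
  assumes "simple_graph G" "S \<subseteq> verts G" "closed_in G S"
  shows "graph_join (induced G S) {} (induced G (verts G - S)) {} = G"
proof (rule prod_eqI)
  show "verts (graph_join (induced G S) {} (induced G (verts G - S)) {}) = verts G"
    using assms(2) by auto
  have "e \<subseteq> S \<or> e \<subseteq> verts G - S" if e: "e \<in> edges G" for e
  proof (rule simple_edgesD[OF assms(1) e])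
    fix u v assume *: "e = {u, v}" "u \<in> verts G" "v \<in> verts G"
    then have "u \<in> S \<longleftrightarrow> v \<in> S" using e assms(3) by (auto simp: closed_in_def insert_commute)
    with * show ?thesis by auto
  qed
  then show "edges (graph_join (induced G S) {} (induced G (verts G - S)) {}) = edges G"
    by (auto simp: edges_join)
qed

lemma closed_in_join:
  assumes "simple_graph G" "simple_graph H" "verts G \<inter> verts H = {}"
  shows "closed_in (graph_join G {} H {}) (verts G)"
  unfolding closed_in_def
proof (intro allI impI)
  fix u v assume *: "{u, v} \<in> edges (graph_join G {} H {})" "u \<in> verts G"
  then consider "{u, v} \<in> edges G" | "{u, v} \<in> edges H" by (auto simp: edges_join)
  then show "v \<in> verts G"
    by cases (use * assms simple_edge_verts[OF assms(1)] simple_edge_verts[OF assms(2)] in blast)+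
qed

lemma connected_join:
  assumes "simple_graph G" "simple_graph H" "graph_connected G" "graph_connected H"
    and "r \<in> verts G" "s \<in> verts H"
  shows "graph_connected (graph_join G {r} H {s})"
proof -
  let ?J = "graph_join G {r} H {s}"
  have "adj G \<subseteq> adj ?J" "adj H \<subseteq> adj ?J" "(r, s) \<in> adj ?J"
    by (auto simp: adj_def edges_join)
  then have mono: "(u, v) \<in> (adj ?J)\<^sup>*" if "(u, v) \<in> (adj G)\<^sup>* \<or> (u, v) \<in> (adj H)\<^sup>*" for u v
    using that rtrancl_mono by blast
  have r: "(r, x) \<in> (adj ?J)\<^sup>*" if "x \<in> verts ?J" for x
  proof (cases "x \<in> verts G")
    case True
    then show ?thesis using assms mono by (simp add: graph_connected_def)
  next
    case False
    then have "(s, x) \<in> (adj ?J)\<^sup>*" using that assms mono by (simp add: graph_connected_def)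
    with \<open>(r, s) \<in> adj ?J\<close> show ?thesis by (rule converse_rtrancl_into_rtrancl)
  qed
  show ?thesis
    unfolding graph_connected_def
    using assms(5) r by (auto intro: rtrancl_trans[OF rtrancl_adj_sym])
qed

lemma relabel_relabel: "relabel g (relabel f G) = relabel (g \<circ> f) G"
  by (simp add: relabel_def image_image)

lemma relabel_ident:
  assumes "simple_graph G" "\<And>v. v \<in> verts G \<Longrightarrow> f v = v"
  shows "relabel f G = G"
proof -
  have "f ` e = e" if "e \<in> edges G" for e
    by (rule simple_edgesD[OF assms(1) that]) (use assms(2) in simp)
  then show ?thesis using assms(2) by (intro prod_eqI) (simp_all add: relabel_def)
qed

lemma induced_relabel:
  assumes "simple_graph G" "inj_on f (verts G)" "S \<subseteq> verts G"
  shows "induced (relabel f G) (f ` S) = relabel f (induced G S)"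
proof (rule prod_eqI)
  have "f ` e \<subseteq> f ` S \<longleftrightarrow> e \<subseteq> S" if "e \<in> edges G" for e
    using inj_on_image_subset_iff[OF assms(2) _ assms(3)] simple_edgesD[OF assms(1) that]
    by (metis empty_subsetI insert_subset)
  then show "edges (induced (relabel f G) (f ` S)) = edges (relabel f (induced G S))"
    by (auto simp: edges_relabel)
qed simp

lemma closed_in_relabel:
  assumes "simple_graph G" "inj_on f (verts G)" "S \<subseteq> verts G"
  shows "closed_in (relabel f G) (f ` S) \<longleftrightarrow> closed_in G S"
proof
  assume l: "closed_in (relabel f G) (f ` S)"
  show "closed_in G S"
    unfolding closed_in_def
  proof (intro allI impI)
    fix u v assume *: "{u, v} \<in> edges G" "u \<in> S"
    note uv = simple_edge_verts[OF assms(1) *(1)]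
    have "f v \<in> f ` S"
      using l * edge_relabel_iff[OF assms(1,2) uv(1,2)] unfolding closed_in_def by blast
    then show "v \<in> S" using inj_on_image_mem_iff[OF assms(2) uv(2) assms(3)] by simp
  qed
next
  assume r: "closed_in G S"
  show "closed_in (relabel f G) (f ` S)"
    unfolding closed_in_def
  proof (intro allI impI)
    fix x y assume *: "{x, y} \<in> edges (relabel f G)" "x \<in> f ` S"
    then have "x \<in> f ` verts G" "y \<in> f ` verts G"
      using simple_edge_verts[OF simple_relabel[OF assms(1,2)] *(1)] by simp_all
    then obtain u v where uv: "u \<in> verts G" "v \<in> verts G" "x = f u" "y = f v" by blast
    with * have "{u, v} \<in> edges G" "u \<in> S"
      using edge_relabel_iff[OF assms(1,2) uv(1,2)] inj_on_image_mem_iff[OF assms(2) uv(1) assms(3)]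
      by simp_all
    with r uv show "y \<in> f ` S" unfolding closed_in_def by blast
  qed
qed

lemma connected_relabel:
  assumes "simple_graph G" "inj_on f (verts G)"
  shows "graph_connected (relabel f G) \<longleftrightarrow> graph_connected G"
proof -
  have "(\<forall>X\<subseteq>f ` verts G. closed_in (relabel f G) X \<longrightarrow> X \<noteq> {} \<longrightarrow> X = f ` verts G) \<longleftrightarrow>
      (\<forall>X\<subseteq>verts G. closed_in (relabel f G) (f ` X) \<longrightarrow> f ` X \<noteq> {} \<longrightarrow> f ` X = f ` verts G)"
    by (simp add: all_subset_image)
  also have "\<dots> \<longleftrightarrow> (\<forall>X\<subseteq>verts G. closed_in G X \<longrightarrow> X \<noteq> {} \<longrightarrow> X = verts G)"
    using closed_in_relabel[OF assms] inj_on_image_eq_iff[OF assms(2) _ subset_refl] by auto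
  finally show ?thesis
    by (simp add: connected_iff_closed assms simple_relabel)
qed

section \<open>Splitting sums over the members of an addable class\<close>

definition invariant :: "(nat graph \<Rightarrow> 'a) \<Rightarrow> bool" where
  "invariant P \<longleftrightarrow> (\<forall>G f. simple_graph G \<longrightarrow> inj_on f (verts G) \<longrightarrow> P (relabel f G) = P G)"

lemma invariantD: "invariant P \<Longrightarrow> simple_graph G \<Longrightarrow> inj_on f (verts G) \<Longrightarrow> P (relabel f G) = P G"
  unfolding invariant_def by blast

lemma invariant_connected: "invariant graph_connected"
  by (simp add: invariant_def connected_relabel)

lemma invariant_utyp: "invariant (utyp k)"
  by (simp add: invariant_def utyp_relabel)

locale addable_class =
  fixes C :: "nat graph set"
  assumes graph_class: "graph_class C" and addable: "addable C"
begin

text \<open>The pieces of a split graph live on arbitrary label sets; for invariant weights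
  \<open>sum_members\<close> brings them back to an initial segment.\<close>

definition members :: "nat set \<Rightarrow> nat graph set" where
  "members V = {G \<in> C. verts G = V}"

lemma members_atLeastAtMost: "members {1..n} = graphs_on C n"
  by (simp add: members_def graphs_on_def)

lemma simple: "G \<in> C \<Longrightarrow> simple_graph G"
  using graph_class by (simp add: graph_class_def)

lemma relabel_in: "G \<in> C \<Longrightarrow> inj_on f (verts G) \<Longrightarrow> relabel f G \<in> C"
  using graph_class graph_iso_relabel simple_relabel simple unfolding graph_class_def by blast

lemma finite_members: "finite V \<Longrightarrow> finite (members V)"
proof (rule finite_subset)
  show "members V \<subseteq> {V} \<times> Pow (Pow V)"
  proof
    fix G assume "G \<in> members V"
    then have "simple_graph G" "verts G = V" using simple by (auto simp: members_def)
    then show "G \<in> {V} \<times> Pow (Pow V)" by (cases G) (auto simp: simple_graph_def)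
  qed
qed simp

lemma in_class_split:
  assumes "simple_graph G" "S \<subseteq> verts G" "closed_in G S"
  shows "G \<in> C \<longleftrightarrow> induced G S \<in> C \<and> induced G (verts G - S) \<in> C"
  using addable assms components_split[OF assms] simple_induced[OF assms(1)]
  unfolding addable_def decomposable_def by (metis Diff_subset Un_subset_iff)

lemma disjoint_union_in:
  assumes "G \<in> C" "H \<in> C" "verts G \<inter> verts H = {}"
  shows "graph_join G {} H {} \<in> C"
proof -
  note s = simple[OF assms(1)] simple[OF assms(2)]
  have "verts (graph_join G {} H {}) - verts G = verts H" using assms(3) by auto
  then show ?thesis
    using in_class_split[OF simple_join[OF s assms(3)], of "{}" "{}" "verts G"]
      closed_in_join[OF s assms(3)] induced_join[OF s assms(3), of "{}" "{}"] assms(1,2)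
    by simp
qed

lemma bridge_in:
  assumes "G \<in> C" "u \<in> verts G" "v \<in> verts G" "(u, v) \<notin> (adj G)\<^sup>*"
  shows "add_edge G u v \<in> C"
proof -
  have "v \<in> cls G v" "v \<notin> cls G u" using assms by (simp_all add: cls_def)
  then have "component G u \<noteq> component G v"
    by (metis component_eq_induced verts_induced)
  then show ?thesis using addable assms unfolding addable_def bridge_addable_def by blast
qed

lemma join_in:
  assumes "G \<in> C" "H \<in> C" "verts G \<inter> verts H = {}" "r \<in> verts G" "s \<in> verts H"
  shows "graph_join G {r} H {s} \<in> C"
proof -
  have "graph_join G {r} H {s} = add_edge (graph_join G {} H {}) r s"
    by (simp add: graph_join_def add_edge_def)
  moreover have "(r, s) \<notin> (adj (graph_join G {} H {}))\<^sup>*"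
    using closed_in_rtrancl[OF closed_in_join[OF simple[OF assms(1)] simple[OF assms(2)] assms(3)] assms(4)]
      assms(3,5) by blast
  ultimately show ?thesis
    using bridge_in[OF disjoint_union_in[OF assms(1-3)]] assms(4,5) by simp
qed

lemma sum_members_bij:
  assumes "bij_betw f V W" "invariant P"
  shows "sum P (members V) = sum P (members W)"
proof (rule sum.reindex_bij_witness)
  let ?g = "inv_into V f"
  have g: "bij_betw ?g W V" using assms(1) by (rule bij_betw_inv_into)
  have gf: "?g (f v) = v" if "v \<in> V" for v using assms(1) that by (rule bij_betw_inv_into_left)
  have fg: "f (?g w) = w" if "w \<in> W" for w using assms(1) that by (rule bij_betw_inv_into_right)
  have i: "inj_on f V" "f ` V = W" "inj_on ?g W" "?g ` W = V"
    using assms(1) g by (auto simp: bij_betw_def)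
  fix G
  show "relabel f (relabel ?g G) = G" "relabel ?g G \<in> members V" if "G \<in> members W"
    using that i fg relabel_in[of G ?g] relabel_ident[OF simple, of G "f \<circ> ?g"]
    by (auto simp: members_def relabel_relabel)
  show "relabel ?g (relabel f G) = G" "relabel f G \<in> members W" "P (relabel f G) = P G"
    if "G \<in> members V"
    using that i gf relabel_in[of G f] relabel_ident[OF simple, of G "?g \<circ> f"] invariantD[OF assms(2) simple]
    by (auto simp: members_def relabel_relabel)
qed

lemma sum_members:
  assumes "finite V" "invariant P"
  shows "sum P (members V) = sum P (graphs_on C (card V))"
proof -
  obtain f where "bij_betw f V {1..card V}"
    using ex_bij_betw_finite_nat[OF assms(1)] bij_betw_iff_card[OF assms(1), of "{1..card V}"] by auto
  then show ?thesis
    using sum_members_bij[OF _ assms(2)] members_atLeastAtMost by metis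
qed

text \<open>By decomposability a member with a marked closed set \<open>S\<close> is the same thing
  as a pair of members on \<open>S\<close> and on its complement. This is the weighted product rule
  of exponential generating functions.\<close>

lemma sum_closed_split:
  fixes P Q :: "nat graph \<Rightarrow> real"
  assumes "finite V"
  shows "(\<Sum>G\<in>members V. \<Sum>S | (S \<subseteq> V \<and> card S = h) \<and> closed_in G S. P (induced G S) * Q (induced G (V - S)))
    = (\<Sum>S | S \<subseteq> V \<and> card S = h. sum P (members S) * sum Q (members (V - S)))"
proof -
  let ?B = "{S. S \<subseteq> V \<and> card S = h}"
  have fin: "finite (members V)" "finite ?B" using assms by (simp_all add: finite_members)
  have "(\<Sum>G\<in>members V. \<Sum>S | S \<in> ?B \<and> closed_in G S. P (induced G S) * Q (induced G (V - S)))
      = (\<Sum>S\<in>?B. \<Sum>G | G \<in> members V \<and> closed_in G S. P (induced G S) * Q (induced G (V - S)))"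
    using fin by (rule sum.swap_restrict)
  also have "\<dots> = (\<Sum>S\<in>?B. sum P (members S) * sum Q (members (V - S)))"
  proof (rule sum.cong[OF refl])
    fix S assume "S \<in> ?B"
    then have S: "S \<subseteq> V" by simp
    have "(\<Sum>G | G \<in> members V \<and> closed_in G S. P (induced G S) * Q (induced G (V - S))) =
        (\<Sum>(G, H)\<in>members S \<times> members (V - S). P G * Q H)"
    proof (rule sum.reindex_bij_witness)
      fix G assume G: "G \<in> {G. G \<in> members V \<and> closed_in G S}"
      then have s: "simple_graph G" "verts G = V" "G \<in> C" "closed_in G S"
        using simple by (auto simp: members_def)
      show "(\<lambda>(G, H). graph_join G {} H {}) (induced G S, induced G (V - S)) = G"
        using join_induced[OF s(1) _ s(4)] S s(2) by simp
      show "(induced G S, induced G (V - S)) \<in> members S \<times> members (V - S)"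
        using in_class_split[OF s(1) _ s(4)] S s by (simp add: members_def)
      show "(case (induced G S, induced G (V - S)) of (G, H) \<Rightarrow> P G * Q H) =
          P (induced G S) * Q (induced G (V - S))" by simp
    next
      fix GH assume "GH \<in> members S \<times> members (V - S)"
      then obtain G H where GH: "GH = (G, H)" "G \<in> C" "H \<in> C" "verts G = S" "verts H = V - S"
        by (auto simp: members_def)
      then have s: "simple_graph G" "simple_graph H" "verts G \<inter> verts H = {}" using simple by auto
      show "(induced ((\<lambda>(G, H). graph_join G {} H {}) GH) S, induced ((\<lambda>(G, H). graph_join G {} H {}) GH) (V - S)) = GH"
        using induced_join[OF s, of "{}" "{}"] GH by simp
      show "(\<lambda>(G, H). graph_join G {} H {}) GH \<in> {G. G \<in> members V \<and> closed_in G S}"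
        using disjoint_union_in[OF GH(2,3) s(3)] closed_in_join[OF s] GH S by (auto simp: members_def)
    qed
    also have "\<dots> = sum P (members S) * sum Q (members (V - S))"
      by (simp add: sum_product sum.cartesian_product)
    finally show "(\<Sum>G | G \<in> members V \<and> closed_in G S. P (induced G S) * Q (induced G (V - S))) =
        sum P (members S) * sum Q (members (V - S))" .
  qed
  finally show ?thesis by simp
qed

lemma sum_closed_graphs_on:
  fixes P Q :: "nat graph \<Rightarrow> real"
  assumes "invariant P" "invariant Q"
  shows "(\<Sum>G\<in>graphs_on C n. \<Sum>S | (S \<subseteq> {1..n} \<and> card S = h) \<and> closed_in G S.
      P (induced G S) * Q (induced G ({1..n} - S)))
    = real (n choose h) * (sum P (graphs_on C h) * sum Q (graphs_on C (n - h)))"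
proof -
  have "sum P (members S) * sum Q (members ({1..n} - S)) = sum P (graphs_on C h) * sum Q (graphs_on C (n - h))"
    if "S \<in> {S. S \<subseteq> {1..n} \<and> card S = h}" for S
  proof -
    have S: "finite S" "card S = h" "card ({1..n} - S) = n - h"
      using that by (auto simp: card_Diff_subset finite_subset)
    then show ?thesis using sum_members[OF S(1) assms(1)] sum_members[of "{1..n} - S", OF _ assms(2)] by simp
  qed
  then have "(\<Sum>S | S \<subseteq> {1..n} \<and> card S = h. sum P (members S) * sum Q (members ({1..n} - S)))
      = (\<Sum>S | S \<subseteq> {1..n} \<and> card S = h. sum P (graphs_on C h) * sum Q (graphs_on C (n - h)))"
    by (rule sum.cong[OF refl])
  also have "\<dots> = real (n choose h) * (sum P (graphs_on C h) * sum Q (graphs_on C (n - h)))"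
    using n_subsets[of "{1..n}" h] by simp
  finally show ?thesis
    using sum_closed_split[where V = "{1..n}" and h = h and P = P and Q = Q] by (simp only: members_atLeastAtMost) simp
qed

end

section \<open>Counting bridges\<close>

definition num_cls :: "'v graph \<Rightarrow> nat" where
  "num_cls G = card (cls G ` verts G)"

lemma verts_add_edge [simp]: "verts (add_edge G u v) = verts G"
  by (simp add: add_edge_def)

lemma edges_add_edge [simp]: "edges (add_edge G u v) = insert {u, v} (edges G)"
  by (simp add: add_edge_def)

lemma rtrancl_adj_mono:
  assumes "edges G \<subseteq> edges H" "(u, v) \<in> (adj G)\<^sup>*"
  shows "(u, v) \<in> (adj H)\<^sup>*"
proof -
  have "adj G \<subseteq> adj H" using assms(1) by (auto simp: adj_def)
  then show ?thesis using assms(2) rtrancl_mono by blast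
qed

lemma num_cls_add_edge:
  assumes "finite (verts G)" "u \<in> verts G" "v \<in> verts G" "(u, v) \<notin> (adj G)\<^sup>*"
  shows "num_cls (add_edge G u v) < num_cls G"
proof -
  let ?G = "add_edge G u v"
  \<comment> \<open>\<open>h\<close> sends an old class to the new class containing it. It is onto
    but identifies the classes of \<open>u\<close> and \<open>v\<close>, so the number of classes
    drops.\<close>
  define h where "h c = (\<Union>x\<in>c. cls ?G x)" for c
  have h: "h (cls G x) = cls ?G x" if "x \<in> verts G" for x
  proof -
    have "cls ?G y = cls ?G x" if "y \<in> cls G x" for y
    proof -
      have "(x, y) \<in> (adj G)\<^sup>*" using that by (simp add: cls_def)
      then have "(x, y) \<in> (adj ?G)\<^sup>*" by (rule rtrancl_adj_mono[rotated]) auto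
      then show ?thesis using cls_eqI by metis
    qed
    then show ?thesis unfolding h_def using cls_self[OF that] by blast
  qed
  have "cls ?G ` verts G = h ` cls G ` verts G"
    using h by (simp add: image_image)
  moreover have "\<not> inj_on h (cls G ` verts G)"
  proof
    assume inj: "inj_on h (cls G ` verts G)"
    have "(u, v) \<in> adj ?G" by (simp add: adj_def)
    then have "cls ?G u = cls ?G v" by (intro cls_eqI) blast
    then have "cls G u = cls G v"
      using inj_onD[OF inj, of "cls G u" "cls G v"] h assms(2,3) by simp
    then have "v \<in> cls G u" using cls_self[OF assms(3)] by simp
    then show False using assms(4) by (simp add: cls_def)
  qed
  moreover have "finite (cls G ` verts G)" using assms(1) by simp
  ultimately show ?thesis
    unfolding num_cls_def verts_add_edge
    by (metis card_image_le eq_card_imp_inj_on le_neq_implies_less)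
qed

definition bridges :: "'v graph \<Rightarrow> 'v set set" where
  "bridges G = {e \<in> edges G. \<exists>u v. e = {u, v} \<and> (u, v) \<notin> (adj (verts G, edges G - {e}))\<^sup>*}"

lemma finite_edges:
  assumes "simple_graph G"
  shows "finite (edges G)"
proof (rule finite_subset)
  show "edges G \<subseteq> Pow (verts G)" using assms by (auto simp: simple_graph_def)
  show "finite (Pow (verts G))" using assms by (simp add: simple_graph_def)
qed

text \<open>Starting from the edgeless graph and adding bridges one by one, each of them merges two
  classes, and there are at most as many classes as vertices at the start.\<close>

lemma card_bridges:
  assumes "simple_graph G"
  shows "card (bridges G) \<le> card (verts G)"
proof -
  have fin: "finite (verts G)" using assms by (simp add: simple_graph_def)
  have "card F + num_cls (verts G, F) \<le> card (verts G)" if "finite F" "F \<subseteq> bridges G" for F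
    using that
  proof (induction F rule: finite_induct)
    case empty
    show ?case using card_image_le[OF fin, of "cls (verts G, {})"] by (simp add: num_cls_def)
  next
    case (insert e F)
    then obtain u v where e: "e = {u, v}" "e \<in> edges G" "(u, v) \<notin> (adj (verts G, edges G - {e}))\<^sup>*"
      by (auto simp: bridges_def)
    have "F \<subseteq> edges G - {e}" using insert by (auto simp: bridges_def)
    then have "(u, v) \<notin> (adj (verts G, F))\<^sup>*"
      using e(3) rtrancl_adj_mono[of "(verts G, F)" "(verts G, edges G - {e})"] by auto
    moreover have "u \<in> verts G" "v \<in> verts G" using simple_edge_verts[OF assms] e(1,2) by blast+
    ultimately have "num_cls (add_edge (verts G, F) u v) < num_cls (verts G, F)"
      using num_cls_add_edge[of "(verts G, F)" u v] fin by simp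
    moreover have "add_edge (verts G, F) u v = (verts G, insert e F)"
      by (simp add: add_edge_def e(1))
    ultimately show ?case using insert by simp
  qed
  moreover have "finite (bridges G)" using finite_edges[OF assms] by (simp add: bridges_def)
  ultimately show ?thesis by (meson add_leD1 subset_refl)
qed

lemma card_bridge_pairs:
  assumes "simple_graph G"
  shows "finite {(u, v). {u, v} \<in> bridges G}" "card {(u, v). {u, v} \<in> bridges G} \<le> 2 * card (verts G)"
proof -
  have fin: "finite (bridges G)" using finite_edges[OF assms] by (simp add: bridges_def)
  have eq: "{(u, v). {u, v} \<in> bridges G} = (\<Union>e\<in>bridges G. {(u, v). {u, v} = e})" by auto
  have one: "finite {(u, v). {u, v} = e} \<and> card {(u, v). {u, v} = e} \<le> 2" if "e \<in> bridges G" for e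
  proof -
    have "e \<in> edges G" using that by (simp add: bridges_def)
    then obtain a b where ab: "e = {a, b}" by (rule simple_edgesD[OF assms])
    then have sub: "{(u, v). {u, v} = e} \<subseteq> {(a, b), (b, a)}" by (auto simp: doubleton_eq_iff)
    have "card {(a, b), (b, a)} \<le> 2" using card_insert_le_m1[of 2 "{(b, a)}" "(a, b)"] by simp
    then show ?thesis
      using card_mono[OF _ sub] finite_subset[OF sub] by simp
  qed
  show "finite {(u, v). {u, v} \<in> bridges G}" unfolding eq using fin one by (intro finite_UN_I) auto
  have "card {(u, v). {u, v} \<in> bridges G} \<le> (\<Sum>e\<in>bridges G. card {(u, v). {u, v} = e})"
    unfolding eq by (rule card_UN_le[OF fin])
  also have "\<dots> \<le> (\<Sum>e\<in>bridges G. 2)" using one by (intro sum_mono) blast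
  also have "\<dots> \<le> 2 * card (verts G)" using card_bridges[OF assms] by simp
  finally show "card {(u, v). {u, v} \<in> bridges G} \<le> 2 * card (verts G)" .
qed

definition unlinked :: "'v graph \<Rightarrow> ('v \<times> 'v) set" where
  "unlinked G = (SIGMA u:verts G. verts G - cls G u)"

lemma unlinked_iff: "(u, v) \<in> unlinked G \<longleftrightarrow> u \<in> verts G \<and> v \<in> verts G \<and> (u, v) \<notin> (adj G)\<^sup>*"
  by (auto simp: unlinked_def cls_def)

lemma card_unlinked_ge:
  assumes "finite (verts G)" "\<And>u. u \<in> verts G \<Longrightarrow> k \<le> card (verts G - cls G u)"
  shows "card (verts G) * k \<le> card (unlinked G)"
proof -
  have "card (unlinked G) = (\<Sum>u\<in>verts G. card (verts G - cls G u))"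
    unfolding unlinked_def using assms(1) by (intro card_SigmaI) auto
  moreover have "(\<Sum>u\<in>verts G. k) \<le> (\<Sum>u\<in>verts G. card (verts G - cls G u))"
    using assms(2) by (intro sum_mono)
  ultimately show ?thesis by simp
qed

lemma num_cls_le:
  assumes "finite (verts G)" "u \<in> verts G"
  shows "num_cls G - 1 \<le> card (verts G - cls G u)"
proof -
  have "cls G ` verts G - {cls G u} \<subseteq> cls G ` (verts G - cls G u)"
  proof
    fix c assume "c \<in> cls G ` verts G - {cls G u}"
    then obtain v where v: "c = cls G v" "v \<in> verts G" "cls G v \<noteq> cls G u" by blast
    have "v \<notin> cls G u"
    proof
      assume "v \<in> cls G u"
      then have "cls G u = cls G v" by (intro cls_eqI) (simp add: cls_def)
      then show False using v(3) by simp
    qed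
    with v show "c \<in> cls G ` (verts G - cls G u)" by blast
  qed
  then have "card (cls G ` verts G - {cls G u}) \<le> card (cls G ` (verts G - cls G u))"
    using assms(1) by (intro card_mono) auto
  also have "\<dots> \<le> card (verts G - cls G u)" using assms(1) by (intro card_image_le) auto
  finally show ?thesis using assms by (simp add: num_cls_def)
qed

lemma connected_if_num_cls:
  assumes "finite (verts G)" "verts G \<noteq> {}" "num_cls G \<le> 1"
  shows "graph_connected G"
  unfolding graph_connected_def
proof (intro conjI ballI)
  fix u v assume uv: "u \<in> verts G" "v \<in> verts G"
  have "card (cls G ` verts G) \<le> Suc 0" using assms(3) by (simp add: num_cls_def)
  then have "\<forall>a\<in>cls G ` verts G. \<forall>b\<in>cls G ` verts G. a = b"
    using card_le_Suc0_iff_eq[of "cls G ` verts G"] assms(1) by blast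
  then have "cls G u = cls G v" using uv by (metis imageI)
  then have "v \<in> cls G u" using cls_self[OF uv(2)] by simp
  then show "(u, v) \<in> (adj G)\<^sup>*" by (simp add: cls_def)
qed (fact assms(2))

section \<open>Bridge counting in the class: components and the giant component\<close>

context addable_class
begin

lemma finite_graphs_on [simp]: "finite (graphs_on C n)"
  by (rule finite_graphs_on[OF graph_class])

lemma graphs_onD:
  assumes "G \<in> graphs_on C n"
  shows "G \<in> C" "verts G = {1..n}" "simple_graph G"
  using assms simple by (auto simp: graphs_on_def)

text \<open>Double counting of graphs with an ordered bridge. A graph in \<open>A\<close> has at
  least \<open>n * k\<close> ordered pairs that can be joined, each producing a bridge of a graph in
  \<open>B\<close>; keeping the pair makes this injective. A graph in \<open>B\<close> has at most
  \<open>n\<close> bridges, hence \<open>2 * n\<close> ordered ones, and \<open>n\<close>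
  cancels.\<close>

lemma bridge_count:
  assumes "A \<subseteq> graphs_on C n" "B \<subseteq> graphs_on C n"
    and "\<And>G u v. G \<in> A \<Longrightarrow> (u, v) \<in> unlinked G \<Longrightarrow> add_edge G u v \<in> B"
    and "\<And>G u. G \<in> A \<Longrightarrow> u \<in> verts G \<Longrightarrow> k \<le> card (verts G - cls G u)"
    and "n > 0"
  shows "card A * k \<le> 2 * card B"
proof -
  have fin: "finite A" "finite B" using assms(1,2) by (auto intro: finite_subset)
  have finu: "finite (unlinked G)" if "G \<in> A" for G
  proof -
    have "unlinked G \<subseteq> verts G \<times> verts G" by (auto simp: unlinked_iff)
    moreover have "finite (verts G)" using graphs_onD(2)[OF subsetD[OF assms(1) that]] by simp
    ultimately show ?thesis using finite_subset by blast
  qed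
  let ?bp = "\<lambda>G. {(u, v). {u, v} \<in> bridges G}"
  let ?f = "\<lambda>(G, u, v). (add_edge G u v, u, v)"
  have bp: "finite (?bp G)" "card (?bp G) \<le> 2 * n" if "G \<in> B" for G
    using card_bridge_pairs[of G] graphs_onD[of G n] assms(2) that by auto
  have notin: "{u, v} \<notin> edges G" if "(u, v) \<in> unlinked G" for G :: "nat graph" and u v
    using that by (auto simp: unlinked_iff adj_def)
  have "inj_on ?f (SIGMA G:A. unlinked G)"
  proof (rule inj_onI)
    fix x y assume *: "x \<in> (SIGMA G:A. unlinked G)" "y \<in> (SIGMA G:A. unlinked G)" "?f x = ?f y"
    obtain G u v where x: "x = (G, u, v)" by (cases x) auto
    obtain H u' v' where y: "y = (H, u', v')" by (cases y) auto
    have uv: "u' = u" "v' = v" "add_edge G u v = add_edge H u v" using * x y by auto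
    then have "verts G = verts H" "insert {u, v} (edges G) = insert {u, v} (edges H)"
      by (metis verts_add_edge, metis edges_add_edge)
    moreover have "{u, v} \<notin> edges G" "{u, v} \<notin> edges H" using * x y uv notin by auto
    ultimately have "G = H" by (intro prod_eqI) (simp_all add: insert_ident)
    then show "x = y" using x y uv by simp
  qed
  moreover have "?f ` (SIGMA G:A. unlinked G) \<subseteq> (SIGMA G:B. ?bp G)"
  proof
    fix x assume "x \<in> ?f ` (SIGMA G:A. unlinked G)"
    then obtain G u v where *: "x = (add_edge G u v, u, v)" "G \<in> A" "(u, v) \<in> unlinked G" by auto
    have "insert {u, v} (edges G) - {{u, v}} = edges G" using notin[OF *(3)] by auto
    then have "{u, v} \<in> bridges (add_edge G u v)"
      using *(3) unfolding bridges_def unlinked_iff by auto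
    then show "x \<in> (SIGMA G:B. ?bp G)" using * assms(3) by auto
  qed
  moreover have "finite (SIGMA G:B. ?bp G)" using fin(2) bp(1) by (rule finite_SigmaI)
  ultimately have "card (SIGMA G:A. unlinked G) \<le> card (SIGMA G:B. ?bp G)"
    by (rule card_inj_on_le)
  moreover have "card (SIGMA G:B. ?bp G) = (\<Sum>G\<in>B. card (?bp G))"
    using fin(2) bp(1) by (intro card_SigmaI) blast+
  moreover have "(\<Sum>G\<in>B. card (?bp G)) \<le> (\<Sum>G\<in>B. 2 * n)"
    using bp(2) by (rule sum_mono)
  moreover have "card (SIGMA G:A. unlinked G) = (\<Sum>G\<in>A. card (unlinked G))"
    using fin(1) finu by (intro card_SigmaI) blast+
  moreover have "(\<Sum>G\<in>A. n * k) \<le> (\<Sum>G\<in>A. card (unlinked G))"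
  proof (rule sum_mono)
    fix G assume "G \<in> A"
    then show "n * k \<le> card (unlinked G)"
      using card_unlinked_ge[of G k] assms(1,4) graphs_onD[of G n] by auto
  qed
  ultimately have "(\<Sum>G\<in>A. n * k) \<le> (\<Sum>G\<in>B. 2 * n)" by linarith
  then have "n * (card A * k) \<le> n * (2 * card B)" by (simp add: mult_ac)
  then show ?thesis using assms(5) by simp
qed

lemma add_edge_graphs_on:
  assumes "G \<in> graphs_on C n" "(u, v) \<in> unlinked G"
  shows "add_edge G u v \<in> graphs_on C n"
  using assms bridge_in[of G u v] by (auto simp: graphs_on_def unlinked_iff)

lemma num_cls_tail:
  assumes "n > 0"
  shows "k * card {G \<in> graphs_on C n. k < num_cls G} \<le> 2 * card (graphs_on C n)"
proof -
  have "card {G \<in> graphs_on C n. k < num_cls G} * k \<le> 2 * card (graphs_on C n)"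
  proof (rule bridge_count)
    fix G u assume "G \<in> {G \<in> graphs_on C n. k < num_cls G}" "u \<in> verts G"
    then show "k \<le> card (verts G - cls G u)"
      using num_cls_le[of G u] graphs_onD[of G n] by auto
  qed (use assms add_edge_graphs_on in auto)
  then show ?thesis by (simp add: mult.commute)
qed

text \<open>With \<open>k + 1\<close> components every vertex has at least \<open>k\<close> partners
  in other components, and joining leaves at most \<open>k\<close> components. So the additional
  graphs are at most \<open>2 / k \<le> 2\<close> times as many as the old ones, and
  \<open>3 = 2 + 1\<close>.\<close>

lemma num_cls_step:
  assumes "n > 0" "k > 0"
  shows "card {G \<in> graphs_on C n. num_cls G \<le> Suc k} \<le> 3 * card {G \<in> graphs_on C n. num_cls G \<le> k}"
proof -
  let ?A = "{G \<in> graphs_on C n. num_cls G = Suc k}" and ?B = "{G \<in> graphs_on C n. num_cls G \<le> k}"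
  have "card ?A * k \<le> 2 * card ?B"
  proof (rule bridge_count)
    fix G u v assume G: "G \<in> ?A" and uv: "(u, v) \<in> unlinked G"
    have "num_cls (add_edge G u v) < num_cls G"
      using num_cls_add_edge[of G u v] G uv graphs_onD[of G n] by (auto simp: unlinked_iff)
    then show "add_edge G u v \<in> ?B" using G add_edge_graphs_on[OF _ uv] by auto
  next
    fix G u assume "G \<in> ?A" "u \<in> verts G"
    then show "k \<le> card (verts G - cls G u)"
      using num_cls_le[of G u] graphs_onD[of G n] by auto
  qed (use assms in auto)
  moreover have "card ?A \<le> card ?A * k" using assms(2) by simp
  moreover have "{G \<in> graphs_on C n. num_cls G \<le> Suc k} = ?A \<union> ?B" by auto
  then have "card {G \<in> graphs_on C n. num_cls G \<le> Suc k} \<le> card ?A + card ?B"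
    using card_Un_le[of ?A ?B] by simp
  ultimately show ?thesis by linarith
qed

text \<open>By the tail bound at least half of the graphs have at most four components. The three
  steps from four down to one cost a factor \<open>3\<close> each, and
  \<open>54 = 2 * 3 ^ 3\<close>.\<close>

lemma connected_count:
  assumes "n > 0"
  shows "card (graphs_on C n) \<le> 54 * card {G \<in> graphs_on C n. graph_connected G}"
proof -
  let ?K = "\<lambda>k. card {G \<in> graphs_on C n. num_cls G \<le> k}"
  have "?K 2 \<le> 3 * ?K 1" "?K 3 \<le> 3 * ?K 2" "?K 4 \<le> 3 * ?K 3"
    using num_cls_step[OF assms, of 1] num_cls_step[OF assms, of 2] num_cls_step[OF assms, of 3]
    by (simp_all add: numeral_2_eq_2 numeral_3_eq_3 eval_nat_numeral)
  moreover have "?K 1 \<le> card {G \<in> graphs_on C n. graph_connected G}"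
  proof (rule card_mono)
    show "{G \<in> graphs_on C n. num_cls G \<le> 1} \<subseteq> {G \<in> graphs_on C n. graph_connected G}"
    proof clarify
      fix V E assume *: "(V, E) \<in> graphs_on C n" "num_cls (V, E) \<le> 1"
      then show "graph_connected (V, E)"
        using connected_if_num_cls[of "(V, E)"] graphs_onD(2)[OF *(1)] assms by simp
    qed
  qed simp
  moreover have "4 * card {G \<in> graphs_on C n. 4 < num_cls G} \<le> 2 * card (graphs_on C n)"
    by (rule num_cls_tail[OF assms])
  moreover have "card (graphs_on C n) = ?K 4 + card {G \<in> graphs_on C n. 4 < num_cls G}"
  proof -
    have "graphs_on C n = {G \<in> graphs_on C n. num_cls G \<le> 4} \<union> {G \<in> graphs_on C n. 4 < num_cls G}"
      by auto
    moreover have "{G \<in> graphs_on C n. num_cls G \<le> 4} \<inter> {G \<in> graphs_on C n. 4 < num_cls G} = {}"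
      by auto
    ultimately show ?thesis
      using card_Un_disjoint[of "{G \<in> graphs_on C n. num_cls G \<le> 4}" "{G \<in> graphs_on C n. 4 < num_cls G}"]
      by simp
  qed
  ultimately show ?thesis by linarith
qed

text \<open>A component of order at least \<open>n - K\<close> would have a closed complement of
  order at most \<open>K\<close>. In these graphs every vertex therefore has more than
  \<open>K\<close> vertices outside its component, and \<open>bridge_count\<close> applies with the
  whole class as target.\<close>

lemma fragment_tail:
  assumes "n > 0"
  shows "Suc K * card {G \<in> graphs_on C n.
      \<forall>S\<subseteq>{1..n}. closed_in G S \<longrightarrow> card S \<le> K \<longrightarrow> \<not> graph_connected (induced G ({1..n} - S))}
    \<le> 2 * card (graphs_on C n)" (is "_ * card ?A \<le> _")
proof -
  have "card ?A * Suc K \<le> 2 * card (graphs_on C n)"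
  proof (rule bridge_count)
    fix G u assume G: "G \<in> ?A" and u: "u \<in> verts G"
    from G have "G \<in> graphs_on C n" by simp
    note v = graphs_onD(2,3)[OF this]
    let ?S = "verts G - cls G u"
    have "closed_in G ?S" using closed_in_Diff[OF v(2) closed_in_cls[OF v(2)]] .
    moreover have "{1..n} - ?S = cls G u" using v(1) cls_subset[of G u] by auto
    moreover have "graph_connected (induced G (cls G u))" using connected_induced_cls[OF v(2) u] .
    ultimately have "\<not> card ?S \<le> K" using G v(1) by auto
    then show "Suc K \<le> card ?S" by simp
  qed (use assms add_edge_graphs_on in auto)
  then show ?thesis by (simp add: mult.commute)
qed

end

section \<open>Pendant copies\<close>

definition boundary :: "'v graph \<Rightarrow> 'v set \<Rightarrow> 'v set set" where
  "boundary G S = {e \<in> edges G. e \<inter> S \<noteq> {} \<and> \<not> e \<subseteq> S}"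

definition pendant :: "'w graph \<Rightarrow> 'w \<Rightarrow> 'v graph \<Rightarrow> 'v set \<Rightarrow> ('w \<Rightarrow> 'v) \<Rightarrow> 'v \<Rightarrow> bool" where
  "pendant M r G S f v \<longleftrightarrow> bij_betw f (verts M) S \<and> S \<subseteq> verts G \<and> relabel f M = induced G S \<and>
     v \<in> verts G - S \<and> boundary G S = {{f r, v}}"

lemma connected_boundary:
  assumes "graph_connected G" "X \<inter> verts G \<noteq> {}" "\<not> verts G \<subseteq> X"
  shows "boundary G X \<noteq> {}"
proof
  assume "boundary G X = {}"
  then have "closed_in G X" unfolding boundary_def closed_in_def by blast
  then show False using connected_closed assms by blast
qed

lemma boundary_empty_closed: "boundary G X = {} \<Longrightarrow> closed_in G X"
  unfolding boundary_def closed_in_def by blast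

lemma pendant_join:
  assumes "simple_graph G" "pendant M r G S f v"
  shows "G = graph_join (relabel f M) {f r} (induced G (verts G - S)) {v}"
proof (rule prod_eqI)
  show "verts G = verts (graph_join (relabel f M) {f r} (induced G (verts G - S)) {v})"
    using assms(2) by (auto simp: pendant_def)
  have "e \<subseteq> S \<or> e \<subseteq> verts G - S \<or> e = {f r, v}" if e: "e \<in> edges G" for e
  proof (cases "e \<inter> S \<noteq> {} \<and> \<not> e \<subseteq> S")
    case True
    then have "e \<in> boundary G S" using e by (simp add: boundary_def)
    then show ?thesis using assms(2) by (simp add: pendant_def)
  next
    case False
    then show ?thesis using e assms(1) by (auto simp: simple_graph_def)
  qed
  moreover have "{f r, v} \<in> edges G"
    using assms(2) by (auto simp: pendant_def boundary_def)
  moreover have "relabel f M = induced G S" using assms(2) by (simp add: pendant_def)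
  ultimately show "edges G = edges (graph_join (relabel f M) {f r} (induced G (verts G - S)) {v})"
    by (auto simp: edges_join)
qed

lemma pendant_of_join:
  assumes "simple_graph M" "simple_graph G" "r \<in> verts M" "bij_betw f (verts M) S"
    and "S \<inter> verts G = {}" "v \<in> verts G"
  shows "pendant M r (graph_join (relabel f M) {f r} G {v}) S f v"
proof -
  have f: "inj_on f (verts M)" "f ` verts M = S" using assms(4) by (auto simp: bij_betw_def)
  have M: "simple_graph (relabel f M)" "verts (relabel f M) \<inter> verts G = {}"
    using simple_relabel[OF assms(1) f(1)] f(2) assms(5) by simp_all
  have e1: "e \<subseteq> S" if "e \<in> edges (relabel f M)" for e
    using that M(1) f(2) by (auto simp: simple_graph_def)
  have e2: "e \<inter> S = {}" if "e \<in> edges G" for e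
    using that assms(2,5) by (auto simp: simple_graph_def)
  have "f r \<in> S" "v \<notin> S" using assms f by auto
  then have "boundary (graph_join (relabel f M) {f r} G {v}) S = {{f r, v}}"
    using e1 e2 by (auto simp: boundary_def edges_join)
  moreover have "induced (graph_join (relabel f M) {f r} G {v}) S = relabel f M"
    using induced_join(1)[OF M(1) assms(2) M(2), of "{f r}" "{v}"] f assms(3,6) by auto
  ultimately show ?thesis
    unfolding pendant_def using assms(4,6) f \<open>v \<notin> S\<close> by auto
qed

lemma connected_pendant:
  assumes "simple_graph M" "graph_connected M" "pendant M r G S f v"
  shows "graph_connected (induced G S)"
  using assms connected_relabel[OF assms(1), of f]
  by (auto simp: pendant_def bij_betw_def)

text \<open>This makes attaching a copy reversible. A second copy disjoint from \<open>S\<close>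
  either is already pendant in the rest or is joined to the outside only through \<open>S\<close>; a
  copy crossing \<open>S\<close> also has no edge leaving it within the rest. In the last two
  situations the connected rest would lie inside \<open>S'\<close>, which its order forbids.\<close>

lemma pendant_unique:
  assumes M: "simple_graph M" "graph_connected M" "r \<in> verts M"
    and J: "simple_graph J" "pendant M r J S f v" "pendant M r J S' f' v'"
    and G: "graph_connected (induced J (verts J - S))" "card (verts M) < card (verts J - S)"
      "\<And>T g w. \<not> pendant M r (induced J (verts J - S)) T g w"
  shows "S = S'"
proof (rule ccontr)
  assume ne: "S \<noteq> S'"
  let ?W = "verts J - S"
  let ?G = "induced J ?W"
  have fin: "finite (verts M)" "finite (verts J)" using M(1) J(1) by (simp_all add: simple_graph_def)
  have S: "S \<subseteq> verts J" "card S = card (verts M)" "finite S" "f r \<in> S" "v \<in> ?W" "boundary J S = {{f r, v}}"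
    using J(2) fin M(3) bij_betw_same_card[of f] by (auto simp: pendant_def bij_betw_def)
  have S': "S' \<subseteq> verts J" "card S' = card (verts M)" "finite S'" "f' r \<in> S'" "v' \<in> verts J - S'"
      "boundary J S' = {{f' r, v'}}"
    using J(3) fin M(3) bij_betw_same_card[of f'] by (auto simp: pendant_def bij_betw_def)
  have not_cover: "\<not> ?W \<subseteq> S'"
    using card_mono[OF S'(3), of ?W] G(2) S'(2) by auto
  have no_closed: "\<not> closed_in ?G S'" if "S' \<inter> ?W \<noteq> {}"
    using connected_closed[OF G(1), of S'] that not_cover by auto
  have bd: "boundary ?G S' = {e \<in> boundary J S'. e \<subseteq> ?W}"
    by (auto simp: boundary_def)
  have v_edge: "{f r, v} \<in> edges J" using S(6) by (auto simp: boundary_def)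
  have v'_edge: "{f' r, v'} \<in> edges J" using S'(6) by (auto simp: boundary_def)
  show False
  proof (cases "S \<inter> S' = {}")
    case True
    show False
    proof (cases "v \<in> S'")
      case True
      then have "{f r, v} \<in> boundary J S'"
        using v_edge S(4) \<open>S \<inter> S' = {}\<close> by (auto simp: boundary_def)
      then have "boundary J S' = {{f r, v}}" using S'(6) by simp
      then have "boundary ?G S' = {}" using S(4) unfolding bd by auto
      then show False using no_closed True S(5) boundary_empty_closed by blast
    next
      case False
      have "v' \<notin> S"
      proof
        assume "v' \<in> S"
        then have "{f' r, v'} \<in> boundary J S"
          using v'_edge S'(4) \<open>S \<inter> S' = {}\<close> by (auto simp: boundary_def)
        then have "{f' r, v'} = {f r, v}" using S(6) by simp
        then show False
          using S'(4) S(4) \<open>S \<inter> S' = {}\<close> False by (auto simp: doubleton_eq_iff)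
      qed
      moreover have sub: "S' \<subseteq> ?W" using S'(1) \<open>S \<inter> S' = {}\<close> by auto
      ultimately have "boundary ?G S' = {{f' r, v'}}"
        using S'(4,5,6) unfolding bd by auto
      moreover have "induced ?G S' = induced J S'" using sub by (rule induced_induced)
      ultimately have "pendant M r ?G S' f' v'"
        using J(3) sub S'(5) \<open>v' \<notin> S\<close> by (simp add: pendant_def)
      then show False using G(3) by blast
    qed
  next
    case False
    have "\<not> S \<subseteq> S'" using card_subset_eq[OF S'(3), of S] S(2) S'(2) ne by auto
    moreover have "\<not> S' \<subseteq> S" using card_subset_eq[OF S(3), of S'] S(2) S'(2) ne by auto
    ultimately have ne: "boundary (induced J S) S' \<noteq> {}" "boundary (induced J S') S \<noteq> {}"
      using connected_boundary[OF connected_pendant[OF M(1,2) J(2)], of S']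
        connected_boundary[OF connected_pendant[OF M(1,2) J(3)], of S] False by auto
    \<comment> \<open>Equal orders exclude inclusion, so each copy is cut by the other. Since
      \<open>e\<close> is the only edge leaving \<open>S'\<close> and lies inside \<open>S\<close>,
      no edge leaves \<open>S'\<close> within \<open>?G\<close>; \<open>e'\<close> shows that
      \<open>S'\<close> meets \<open>?G\<close>, namely in \<open>v\<close>.\<close>
    obtain e where e: "e \<in> boundary J S'" "e \<subseteq> S" using ne(1) by (auto simp: boundary_def)
    obtain e' where e': "e' \<in> boundary J S" "e' \<subseteq> S'" using ne(2) by (auto simp: boundary_def)
    have "v \<in> S'" using e' S(6) by auto
    moreover have "boundary ?G S' = {}"
      using e S'(6) S(4) S'(4) unfolding bd by auto
    ultimately show False using no_closed S(5) boundary_empty_closed by blast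
  qed
qed

lemma fresh_relabel:
  fixes A B :: "nat set"
  assumes "finite B"
  obtains g :: "nat \<Rightarrow> nat" where "inj g" "g ` A \<inter> B = {}"
proof
  let ?g = "\<lambda>x. x + Suc (Max (insert 0 B))"
  show "inj ?g" by (simp add: inj_def)
  have "?g x \<notin> B" for x
  proof
    assume "?g x \<in> B"
    then have "?g x \<le> Max (insert 0 B)" using assms by (intro Max_ge) auto
    then show False by simp
  qed
  then show "?g ` A \<inter> B = {}" by auto
qed

lemma join_commute: "graph_join G R H S = graph_join H S G R"
  by (rule prod_eqI) (auto simp: edges_join insert_commute)

section \<open>The absorbing type, and the rarity of graphs without its pendant copies\<close>

abbreviation rtype :: "nat \<Rightarrow> 'v graph \<Rightarrow> 'v \<Rightarrow> ty" where
  "rtype k G r \<equiv> htype k G {r} (\<lambda>_. {})"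

lemma rtype_join:
  assumes "simple_graph G" "simple_graph H" "verts G \<inter> verts H = {}" "r \<in> verts G" "s \<in> verts H"
  shows "rtype k (graph_join G {r} H {s}) r = glue (rtype k G r) (rtype k H s)"
  using htype_join[OF assms(1-3), of "{r}" "{s}" "\<lambda>_. {}" "\<lambda>_. {}"] assms(4,5) by simp

lemma rtype_relabel:
  assumes "simple_graph G" "inj_on f (verts G)" "r \<in> verts G"
  shows "rtype k (relabel f G) (f r) = rtype k G r"
  using htype_relabel[OF assms(1,2), of "{r}" "\<lambda>_. {}"] assms(3) by simp

lemma forget_rtype: "simple_graph G \<Longrightarrow> forget (rtype k G r) = utyp k G"
  by (simp add: forget_htype utyp_def)

context addable_class
begin

definition rtypes :: "nat \<Rightarrow> ty set" where
  "rtypes k = {rtype k G r | G r. G \<in> C \<and> graph_connected G \<and> r \<in> verts G}"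

lemma finite_rtypes: "finite (rtypes k)"
proof (rule finite_subset)
  show "finite {htype k G R As | (G :: nat graph) R (As :: nat \<Rightarrow> nat set).
      simple_graph G \<and> (\<forall>i\<ge>0. As i = {})}"
    by (rule finite_types)
  show "rtypes k \<subseteq> {htype k G R As | (G :: nat graph) R (As :: nat \<Rightarrow> nat set).
      simple_graph G \<and> (\<forall>i\<ge>0. As i = {})}"
    unfolding rtypes_def using simple by blast
qed

lemma finite_verts: "G \<in> C \<Longrightarrow> finite (verts G)"
  using simple by (simp add: simple_graph_def)

lemma glue_rtypes:
  assumes "s \<in> rtypes k" "t \<in> rtypes k"
  shows "glue s t \<in> rtypes k"
proof -
  obtain G r where G: "s = rtype k G r" "G \<in> C" "graph_connected G" "r \<in> verts G"
    using assms(1) by (auto simp: rtypes_def)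
  obtain H q where H: "t = rtype k H q" "H \<in> C" "graph_connected H" "q \<in> verts H"
    using assms(2) by (auto simp: rtypes_def)
  obtain g :: "nat \<Rightarrow> nat" where g: "inj g" "g ` verts H \<inter> verts G = {}"
    using fresh_relabel[OF finite_verts[OF G(2)]] by blast
  have gi: "inj_on g (verts H)" using g(1) by (rule inj_on_subset) simp
  let ?H = "relabel g H"
  have H': "?H \<in> C" "graph_connected ?H" "g q \<in> verts ?H" "rtype k ?H (g q) = t" "verts G \<inter> verts ?H = {}"
    using H g relabel_in[OF H(2) gi] connected_relabel[OF simple[OF H(2)] gi]
      rtype_relabel[OF simple[OF H(2)] gi H(4)] by auto
  have "rtype k (graph_join G {r} ?H {g q}) r = glue s t"
    using rtype_join[OF simple[OF G(2)] simple[OF H'(1)] H'(5) G(4) H'(3)] G(1) H'(4) by simp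
  moreover have "graph_join G {r} ?H {g q} \<in> C" using join_in[OF G(2) H'(1) H'(5) G(4) H'(3)] .
  moreover have "graph_connected (graph_join G {r} ?H {g q})"
    using connected_join[OF simple[OF G(2)] simple[OF H'(1)] G(3) H'(2) G(4) H'(3)] .
  moreover have "r \<in> verts (graph_join G {r} ?H {g q})" using G(4) by simp
  ultimately show ?thesis unfolding rtypes_def mem_Collect_eq by metis
qed

text \<open>The rest \<open>H\<close> need not be in \<open>C\<close>, so its type is not absorbed directly; instead the type
  of all of \<open>G\<close> is absorbed by a second copy of \<open>M\<close> attached at the root.\<close>

lemma utyp_if_pendant:
  assumes "M \<in> C" "graph_connected M" "r \<in> verts M"
    and absorb: "\<And>t. t \<in> rtypes k \<Longrightarrow> glue (rtype k M r) t = rtype k M r"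
    and "G \<in> C" "graph_connected G" "pendant M r G S f v"
  shows "utyp k G = utyp k M"
proof -
  let ?m = "rtype k M r"
  let ?H = "induced G (verts G - S)"
  have f: "inj_on f (verts M)" "f ` verts M = S" and v: "v \<in> verts G - S" and S: "S \<subseteq> verts G"
    using assms(7) by (auto simp: pendant_def bij_betw_def)
  note sG = simple[OF assms(5)] and sM = simple[OF assms(1)]
  have fr: "f r \<in> verts G" using f assms(3) S by auto
  define t where "t = rtype k ?H v"
  have G: "G = graph_join (relabel f M) {f r} ?H {v}" using pendant_join[OF sG assms(7)] .
  have "rtype k (graph_join (relabel f M) {f r} ?H {v}) (f r) = glue (rtype k (relabel f M) (f r)) t"
    unfolding t_def using f v assms(3)
    by (intro rtype_join simple_relabel simple_induced sG sM) auto
  then have typG: "rtype k G (f r) = glue ?m t"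
    using G rtype_relabel[OF sM f(1) assms(3)] by simp
  then have mt: "glue ?m t \<in> rtypes k"
    unfolding rtypes_def mem_Collect_eq using assms(5,6) fr by (intro exI[of _ G] exI[of _ "f r"]) simp
  have m: "?m \<in> rtypes k" using assms(1-3) unfolding rtypes_def by blast
  obtain g :: "nat \<Rightarrow> nat" where g: "inj g" "g ` verts M \<inter> verts G = {}"
    using fresh_relabel[OF finite_verts[OF assms(5)]] by blast
  have gi: "inj_on g (verts M)" using g(1) by (rule inj_on_subset) simp
  let ?M = "relabel g M"
  have M': "simple_graph ?M" "g r \<in> verts ?M" "verts ?M \<inter> verts G = {}" "rtype k ?M (g r) = ?m"
    using simple_relabel[OF sM gi] assms(3) g(2) rtype_relabel[OF sM gi assms(3)] by auto
  let ?Z = "graph_join G {f r} ?M {g r}"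
  have sZ: "simple_graph ?Z" using M' fr sG by (intro simple_join) auto
  have "rtype k ?Z (f r) = glue (glue ?m t) ?m"
    using rtype_join[OF sG M'(1) _ fr M'(2)] M'(3,4) typG by (simp add: Int_commute)
  also have "\<dots> = glue (glue ?m ?m) t" by (rule glue_commute)
  also have "\<dots> = rtype k G (f r)" using absorb[OF m] typG by simp
  finally have "utyp k ?Z = utyp k G"
    using forget_rtype[OF sZ] forget_rtype[OF sG] by metis
  moreover have "rtype k ?Z (g r) = glue ?m (glue ?m t)"
    using rtype_join[OF M'(1) sG M'(3,2) fr] M'(4) typG join_commute[of G] by simp
  then have "utyp k ?Z = utyp k M"
    using absorb[OF mt] forget_rtype[OF sZ] forget_rtype[OF sM] by metis
  ultimately show ?thesis by simp
qed

lemma ex_absorbing_graph: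
  assumes "G \<in> C" "graph_connected G"
  obtains M r where "M \<in> C" "graph_connected M" "r \<in> verts M"
    "\<And>t. t \<in> rtypes k \<Longrightarrow> glue (rtype k M r) t = rtype k M r"
proof -
  have "rtypes k \<noteq> {}" using assms unfolding rtypes_def graph_connected_def by blast
  then obtain m where "m \<in> rtypes k" "\<And>t. t \<in> rtypes k \<Longrightarrow> glue m t = m"
    using ex_absorbing[OF finite_rtypes[of k] _ glue_rtypes[of _ k]] by blast
  then show thesis using that unfolding rtypes_def by blast
qed

text \<open>The binomial coefficient counts the label sets of the copy and the factor
  \<open>n\<close> its attachment vertices. This factor \<open>n\<close> is what makes graphs
  without pendant copies rare. Invariance of \<open>Q\<close> makes the count independent of the
  remaining labels.\<close>

lemma pendant_free_count:
  assumes M: "M \<in> C" "graph_connected M" "r \<in> verts M"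
    and Q: "invariant Q" "\<And>G S f v. G \<in> C \<Longrightarrow> graph_connected G \<Longrightarrow> Q G \<Longrightarrow> \<not> pendant M r G S f v"
    and n: "card (verts M) < n"
  shows "((n + card (verts M)) choose card (verts M)) * (card {G \<in> graphs_on C n. graph_connected G \<and> Q G} * n)
    \<le> card (graphs_on C (n + card (verts M)))"
proof -
  let ?m = "card (verts M)"
  let ?N = "{1..n + ?m}"
  let ?SS = "{S. S \<subseteq> ?N \<and> card S = ?m}"
  let ?B = "\<lambda>V. {G \<in> members V. graph_connected G \<and> Q G}"
  let ?D = "SIGMA S:?SS. ?B (?N - S) \<times> (?N - S)"
  have finM: "finite (verts M)" using finite_verts M(1) by blast
  \<comment> \<open>One labelling of the copy is fixed for each label set, so that the triple
    \<open>(S, G, v)\<close> determines the constructed graph.\<close>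
  have "\<exists>f. bij_betw f (verts M) S" if "S \<in> ?SS" for S
    using that finM finite_subset[of S ?N] by (intro finite_same_card_bij) auto
  then obtain f where f: "\<And>S. S \<in> ?SS \<Longrightarrow> bij_betw (f S) (verts M) S" by metis
  define J where "J = (\<lambda>(S, G, v). graph_join (relabel (f S) M) {f S r} G {v})"
  have fin: "finite ?SS" by simp
  have compl: "finite (?N - S)" "card (?N - S) = n" if "S \<in> ?SS" for S
    using that by (auto simp: card_Diff_subset finite_subset)
  have card_B: "card (?B (?N - S)) = card {G \<in> graphs_on C n. graph_connected G \<and> Q G}" if "S \<in> ?SS" for S
  proof -
    let ?P = "\<lambda>G. if graph_connected G \<and> Q G then 1 else 0 :: nat"
    have "invariant ?P" using Q(1) invariant_connected by (simp add: invariant_def)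
    from sum_members[OF compl(1)[OF that] this]
    have "sum ?P (members (?N - S)) = sum ?P (graphs_on C n)"
      unfolding compl(2)[OF that] .
    then show ?thesis
      using compl[OF that] finite_members by (simp add: sum.If_cases Int_def)
  qed
  have J: "pendant M r (J (S, G, v)) S (f S) v" "J (S, G, v) \<in> graphs_on C (n + ?m)"
      "induced (J (S, G, v)) (verts (J (S, G, v)) - S) = G" "verts (J (S, G, v)) - S = ?N - S"
    if "S \<in> ?SS" "G \<in> ?B (?N - S)" "v \<in> ?N - S" for S G v
  proof -
    have G: "G \<in> C" "verts G = ?N - S" using that by (auto simp: members_def)
    have fS: "inj_on (f S) (verts M)" "f S ` verts M = S" using f[OF that(1)] by (auto simp: bij_betw_def)
    let ?M = "relabel (f S) M"
    have M': "?M \<in> C" "verts ?M = S" "f S r \<in> verts ?M" "verts ?M \<inter> verts G = {}"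
      using relabel_in[OF M(1) fS(1)] fS M(3) G(2) by auto
    show "pendant M r (J (S, G, v)) S (f S) v"
      unfolding J_def prod.case
      by (rule pendant_of_join[OF simple[OF M(1)] simple[OF G(1)] M(3) f[OF that(1)]])
        (use G(2) that(3) in auto)
    show "J (S, G, v) \<in> graphs_on C (n + ?m)"
      using join_in[OF M'(1) G(1) M'(4,3), of v] that G(2) M'(2)
      by (auto simp: J_def graphs_on_def)
    show verts: "verts (J (S, G, v)) - S = ?N - S"
      using that G(2) M'(2) by (auto simp: J_def)
    show "induced (J (S, G, v)) (verts (J (S, G, v)) - S) = G"
      unfolding verts unfolding J_def prod.case G(2)[symmetric]
      using M'(3) that(3) G(2)
      by (intro induced_join(2) simple M'(1,4) G(1)) auto
  qed
  have "inj_on J ?D"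
  proof (rule inj_onI)
    fix x y assume *: "x \<in> ?D" "y \<in> ?D" "J x = J y"
    obtain S G v where x: "x = (S, G, v)" by (cases x) auto
    obtain S' G' v' where y: "y = (S', G', v')" by (cases y) auto
    have xD: "S \<in> ?SS" "G \<in> ?B (?N - S)" "v \<in> ?N - S" using *(1) x by auto
    have yD: "S' \<in> ?SS" "G' \<in> ?B (?N - S')" "v' \<in> ?N - S'" using *(2) y by auto
    have eq: "J (S, G, v) = J (S', G', v')" using * x y by simp
    have G: "G \<in> C" "graph_connected G" "Q G" using xD(2) by (auto simp: members_def)
    have S: "S = S'"
    proof (rule pendant_unique)
      show "simple_graph M" "graph_connected M" "r \<in> verts M" using simple M by auto
      show "simple_graph (J (S, G, v))" using J(2)[OF xD] simple by (simp add: graphs_on_def)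
      show "pendant M r (J (S, G, v)) S (f S) v" by (rule J(1)[OF xD])
      show "pendant M r (J (S, G, v)) S' (f S') v'" unfolding eq by (rule J(1)[OF yD])
      show "graph_connected (induced (J (S, G, v)) (verts (J (S, G, v)) - S))"
        unfolding J(3)[OF xD] by (rule G(2))
      show "card (verts M) < card (verts (J (S, G, v)) - S)"
        unfolding J(4)[OF xD] compl(2)[OF xD(1)] by (rule n)
      fix S'' f'' v''
      show "\<not> pendant M r (induced (J (S, G, v)) (verts (J (S, G, v)) - S)) S'' f'' v''"
        unfolding J(3)[OF xD] by (rule Q(2)[OF G])
    qed
    have "G = G'" using J(3)[OF xD] J(3)[OF yD] eq S by simp
    moreover have "v = v'"
    proof -
      have "{{f S r, v}} = {{f S r, v'}}"
        using J(1)[OF xD] J(1)[OF yD] eq S unfolding pendant_def by metis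
      then show ?thesis by (auto simp: doubleton_eq_iff)
    qed
    ultimately show "x = y" using x y S by simp
  qed
  moreover have "J ` ?D \<subseteq> graphs_on C (n + ?m)" using J(2) by auto
  ultimately have "card ?D \<le> card (graphs_on C (n + ?m))"
    by (rule card_inj_on_le) simp
  moreover have "card ?D = (\<Sum>S\<in>?SS. card (?B (?N - S) \<times> (?N - S)))"
    using fin finite_members by (intro card_SigmaI) auto
  moreover have "\<dots> = (\<Sum>S\<in>?SS. card {G \<in> graphs_on C n. graph_connected G \<and> Q G} * n)"
    using card_B compl(2) by (intro sum.cong) (simp_all add: card_cartesian_product)
  moreover have "card ?SS = (n + ?m) choose ?m" using n_subsets[of ?N ?m] by simp
  ultimately show ?thesis by simp
qed

end

section \<open>Limits\<close>

text \<open>Allows the limit in \<open>n\<close> to be taken for a fixed cutoff first, without a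
  formula for the final limit.\<close>

lemma convergent_approx:
  fixes x :: "nat \<Rightarrow> real"
  assumes "\<And>e. e > 0 \<Longrightarrow> \<exists>y. convergent y \<and> (\<forall>\<^sub>F n in sequentially. \<bar>x n - y n\<bar> \<le> e)"
  shows "convergent x"
proof (rule Cauchy_convergent, rule CauchyI)
  fix e :: real assume "e > 0"
  then obtain y where y: "convergent y" "\<forall>\<^sub>F n in sequentially. \<bar>x n - y n\<bar> \<le> e / 4"
    using assms[of "e / 4"] by auto
  obtain N where N: "\<And>m n. m \<ge> N \<Longrightarrow> n \<ge> N \<Longrightarrow> norm (y m - y n) < e / 4"
    using CauchyD[OF convergent_Cauchy[OF y(1)], of "e / 4"] \<open>e > 0\<close> by auto
  obtain N' where N': "\<And>n. n \<ge> N' \<Longrightarrow> \<bar>x n - y n\<bar> \<le> e / 4"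
    using y(2) unfolding eventually_sequentially by blast
  have "norm (x m - x n) < e" if "m \<ge> max N N'" "n \<ge> max N N'" for m n
  proof -
    have "\<bar>x m - x n\<bar> \<le> \<bar>x m - y m\<bar> + \<bar>y m - y n\<bar> + \<bar>x n - y n\<bar>" by linarith
    moreover have "\<bar>y m - y n\<bar> < e / 4" using N[of m n] that by simp
    moreover have "\<bar>x m - y m\<bar> \<le> e / 4" "\<bar>x n - y n\<bar> \<le> e / 4" using N' that by simp_all
    ultimately have "\<bar>x m - x n\<bar> < e" using \<open>e > 0\<close> by linarith
    then show ?thesis by simp
  qed
  then show "\<exists>M. \<forall>m\<ge>M. \<forall>n\<ge>M. norm (x m - x n) < e" by blast
qed

lemma alternating_choose: "(\<Sum>j\<le>J. (- 1) ^ j * real (Suc m choose j)) = (- 1) ^ J * real (m choose J)"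
  by (induction J) (simp_all add: algebra_simps)

text \<open>For \<open>x = Suc m\<close> the truncated sum telescopes, up to sign, to
  \<open>m choose J\<close>, which is one of the two summands of \<open>Suc m choose Suc J\<close>
  in Pascal's rule.\<close>

lemma bonferroni:
  "\<bar>of_bool (x = 0) - (\<Sum>j\<le>J. (- 1) ^ j * real (x choose j))\<bar> \<le> real (x choose Suc J)"
proof (cases x)
  case 0
  have "(\<Sum>j\<le>J. (- 1) ^ j * real (0 choose j)) = (\<Sum>j\<le>J. if j = 0 then 1 else 0)"
    by (intro sum.cong) auto
  then show ?thesis using 0 by simp
next
  case (Suc m)
  then show ?thesis by (simp only: alternating_choose) (simp add: abs_mult power_abs)
qed

lemma connected_subset_closed:
  assumes "graph_connected (induced G S)" "closed_in G T" "S \<inter> T \<noteq> {}"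
  shows "S \<subseteq> T"
proof -
  have "closed_in (induced G S) T" using assms(2) by (auto simp: closed_in_def)
  then show ?thesis using connected_closed[OF assms(1)] assms(3) by auto
qed

section \<open>Small components and the part outside the giant component\<close>

definition small_components :: "nat \<Rightarrow> 'v graph \<Rightarrow> 'v set set" where
  "small_components K G =
     {S. S \<subseteq> verts G \<and> closed_in G S \<and> card S \<le> K \<and> graph_connected (induced G S)}"

lemma finite_small_components: "finite (verts G) \<Longrightarrow> finite (small_components K G)"
  by (rule finite_subset[of _ "Pow (verts G)"]) (auto simp: small_components_def)

lemma small_components_nonempty: "S \<in> small_components K G \<Longrightarrow> S \<noteq> {}"
  by (auto simp: small_components_def graph_connected_def)

lemma small_components_disjoint:
  assumes "S \<in> small_components K G" "T \<in> small_components K G" "S \<noteq> T"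
  shows "S \<inter> T = {}"
  using assms connected_subset_closed[of G S T] connected_subset_closed[of G T S]
  by (auto simp: small_components_def)

lemma closed_in_induced_iff:
  assumes "closed_in G W" "T \<subseteq> W"
  shows "closed_in (induced G W) T \<longleftrightarrow> closed_in G T"
  using assms unfolding closed_in_def by auto

lemma small_components_remove:
  assumes "simple_graph G" "S \<in> small_components K G"
  shows "small_components K (induced G (verts G - S)) = small_components K G - {S}"
proof -
  let ?W = "verts G - S"
  have W: "closed_in G ?W"
    using closed_in_Diff[OF assms(1)] assms(2) by (simp add: small_components_def)
  have "T \<in> small_components K (induced G ?W) \<longleftrightarrow> T \<subseteq> ?W \<and> T \<in> small_components K G" for T
    using closed_in_induced_iff[OF W, of T] induced_induced[of T ?W G]
    by (auto simp: small_components_def)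
  moreover have "T \<subseteq> ?W \<longleftrightarrow> T \<noteq> S" if "T \<in> small_components K G" for T
    using small_components_disjoint[OF that assms(2)] small_components_nonempty[OF that] that
    by (auto simp: small_components_def)
  ultimately show ?thesis by auto
qed

lemma small_components_relabel:
  assumes "simple_graph G" "inj_on f (verts G)"
  shows "small_components K (relabel f G) = (`) f ` small_components K G"
proof -
  have "f ` S \<in> small_components K (relabel f G) \<longleftrightarrow> S \<in> small_components K G" if "S \<subseteq> verts G" for S
  proof -
    have "card (f ` S) = card S" using card_image inj_on_subset[OF assms(2) that] by blast
    moreover have "graph_connected (induced (relabel f G) (f ` S)) \<longleftrightarrow> graph_connected (induced G S)"
      using connected_relabel[OF simple_induced[OF assms(1) that]] inj_on_subset[OF assms(2) that]
      by (simp add: induced_relabel[OF assms that])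
    ultimately show ?thesis
      using that closed_in_relabel[OF assms that] by (auto simp: small_components_def)
  qed
  note iff = this
  show ?thesis
  proof (intro equalityI subsetI)
    fix T assume T: "T \<in> small_components K (relabel f G)"
    then have "T \<subseteq> f ` verts G" by (simp add: small_components_def)
    then obtain S where "S \<subseteq> verts G" "T = f ` S" by (auto simp: subset_image_iff)
    with T iff show "T \<in> (`) f ` small_components K G" by blast
  next
    fix T assume "T \<in> (`) f ` small_components K G"
    then obtain S where "T = f ` S" "S \<in> small_components K G" by blast
    with iff[of S] show "T \<in> small_components K (relabel f G)"
      by (simp add: small_components_def)
  qed
qed

lemma invariant_small_components: "invariant (\<lambda>G. card (small_components K G))"
  unfolding invariant_def
proof (intro allI impI)
  fix G :: "nat graph" and f :: "nat \<Rightarrow> nat" assume *: "simple_graph G" "inj_on f (verts G)"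
  have "inj_on ((`) f) (small_components K G)"
    by (rule inj_on_subset[OF inj_on_image_Pow[OF *(2)]]) (auto simp: small_components_def)
  then show "card (small_components K (relabel f G)) = card (small_components K G)"
    by (simp add: small_components_relabel[OF *] card_image)
qed

lemma invariant_compose: "invariant P \<Longrightarrow> invariant (\<lambda>G. g (P G))"
  by (simp add: invariant_def)

lemma invariant_compose2: "invariant P \<Longrightarrow> invariant Q \<Longrightarrow> invariant (\<lambda>G. g (P G) (Q G))"
  by (simp add: invariant_def)

lemma invariant_const: "invariant (\<lambda>_. c)"
  by (simp add: invariant_def)

text \<open>The candidates for the part outside a giant component: it is the complement of
  \<open>S\<close> that is connected, while \<open>S\<close> may be empty or have several
  components.\<close>

definition fragments :: "nat \<Rightarrow> nat \<Rightarrow> nat graph \<Rightarrow> nat set set" where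
  "fragments n K G = {S. S \<subseteq> {1..n} \<and> closed_in G S \<and> card S \<le> K \<and>
     graph_connected (induced G ({1..n} - S))}"

lemma finite_fragments: "finite (fragments n K G)"
  by (rule finite_subset[of _ "Pow {1..n}"]) (auto simp: fragments_def)

text \<open>Two fragments together miss a vertex, so their complements meet. Both complements are
  connected and closed, hence equal.\<close>

lemma card_fragments_le:
  assumes "simple_graph G" "verts G = {1..n}" "2 * K < n"
  shows "card (fragments n K G) \<le> 1"
proof -
  have sub: "S' \<subseteq> S" if S: "S \<in> fragments n K G" "S' \<in> fragments n K G" for S S'
  proof -
    have fin: "finite S" "finite S'" using S finite_subset[of _ "{1..n}"] by (auto simp: fragments_def)
    have "card (S \<union> S') \<le> 2 * K" using S card_Un_le[of S S'] by (auto simp: fragments_def)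
    then have "\<not> {1..n} \<subseteq> S \<union> S'"
      using card_mono[of "S \<union> S'" "{1..n}"] fin assms(3) by auto
    then have "({1..n} - S) \<inter> ({1..n} - S') \<noteq> {}" by blast
    moreover have "closed_in G ({1..n} - S')"
      using closed_in_Diff[OF assms(1)] S assms(2) by (auto simp: fragments_def)
    ultimately have "{1..n} - S \<subseteq> {1..n} - S'"
      using connected_subset_closed S(1) unfolding fragments_def by blast
    then show ?thesis using S by (auto simp: fragments_def)
  qed
  then have "S = S'" if "S \<in> fragments n K G" "S' \<in> fragments n K G" for S S'
    using that by blast
  then show ?thesis
    using card_le_Suc0_iff_eq[OF finite_fragments] by auto
qed

lemma sum_by_card:
  fixes g :: "nat set \<Rightarrow> real"
  shows "(\<Sum>h\<le>K. \<Sum>S | (S \<subseteq> {1..n} \<and> card S = h) \<and> closed_in G S. g S)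
    = (\<Sum>S | S \<subseteq> {1..n} \<and> closed_in G S \<and> card S \<le> K. g S)"
proof -
  let ?B = "{S. S \<subseteq> {1..n} \<and> closed_in G S \<and> card S \<le> K}"
  have "finite ?B" by (rule finite_subset[of _ "Pow {1..n}"]) auto
  then have "(\<Sum>h\<in>{..K}. \<Sum>S | S \<in> ?B \<and> card S = h. g S) = sum g ?B"
    by (intro sum.group) auto
  moreover have "{S. S \<in> ?B \<and> card S = h} = {S. (S \<subseteq> {1..n} \<and> card S = h) \<and> closed_in G S}"
    if "h \<le> K" for h using that by auto
  ultimately show ?thesis by simp
qed

section \<open>Means over the class and the growth ratio\<close>

locale smooth_class = addable_class +
  assumes smooth: "smooth C"
begin

definition num :: "nat \<Rightarrow> real" where
  "num n = real (card (graphs_on C n))"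

text \<open>The coefficient of the exponential generating function. Factorials absorb the binomial
  coefficients of a splitting, and smoothness becomes convergence of the quotients of consecutive
  weights.\<close>

definition weight :: "nat \<Rightarrow> real" where
  "weight n = num n / fact n"

definition mean :: "nat \<Rightarrow> (nat graph \<Rightarrow> real) \<Rightarrow> real" where
  "mean n P = sum P (graphs_on C n) / num n"

definition csum :: "nat \<Rightarrow> nat \<Rightarrow> (nat graph \<Rightarrow> nat set \<Rightarrow> real) \<Rightarrow> nat graph \<Rightarrow> real" where
  "csum h n f G = (\<Sum>S | (S \<subseteq> {1..n} \<and> card S = h) \<and> closed_in G S. f G S)"

definition split_prod :: "(nat graph \<Rightarrow> real) \<Rightarrow> (nat graph \<Rightarrow> real) \<Rightarrow> nat graph \<Rightarrow> nat set \<Rightarrow> real" where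
  "split_prod P Q G S = P (induced G S) * Q (induced G (verts G - S))"

lemma num_nonneg: "num n \<ge> 0" by (simp add: num_def)

lemma num_pos: "\<forall>\<^sub>F n in sequentially. num n > 0"
proof -
  have "\<forall>\<^sub>F n in sequentially. graphs_on C n \<noteq> {}" using smooth unfolding smooth_def by blast
  then show ?thesis
  proof eventually_elim
    case (elim n)
    then show ?case using card_gt_0_iff[of "graphs_on C n"] by (simp add: num_def)
  qed
qed

lemma weight_nonneg: "weight n \<ge> 0" by (simp add: weight_def num_nonneg)

lemma weight_pos: "\<forall>\<^sub>F n in sequentially. weight n > 0"
  using num_pos by eventually_elim (simp add: weight_def)

lemma mean_mono: "(\<And>G. G \<in> graphs_on C n \<Longrightarrow> P G \<le> Q G) \<Longrightarrow> mean n P \<le> mean n Q"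
  unfolding mean_def by (intro divide_right_mono sum_mono num_nonneg)

lemma mean_cong: "(\<And>G. G \<in> graphs_on C n \<Longrightarrow> P G = Q G) \<Longrightarrow> mean n P = mean n Q"
  unfolding mean_def by (simp cong: sum.cong)

lemma mean_nonneg: "(\<And>G. G \<in> graphs_on C n \<Longrightarrow> 0 \<le> P G) \<Longrightarrow> 0 \<le> mean n P"
  unfolding mean_def by (intro divide_nonneg_nonneg sum_nonneg num_nonneg)

lemma mean_diff: "mean n P - mean n Q = mean n (\<lambda>G. P G - Q G)"
  by (simp add: mean_def sum_subtractf diff_divide_distrib)

lemma mean_sum: "mean n (\<lambda>G. \<Sum>j\<in>J. f j G) = (\<Sum>j\<in>J. mean n (f j))"
  unfolding mean_def by (simp add: sum.swap[of _ J] sum_divide_distrib)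

lemma mean_cmult: "mean n (\<lambda>G. c * P G) = c * mean n P"
  by (simp add: mean_def sum_distrib_left)

lemma mean_abs_diff:
  assumes "\<And>G. G \<in> graphs_on C n \<Longrightarrow> \<bar>P G - Q G\<bar> \<le> R G"
  shows "\<bar>mean n P - mean n Q\<bar> \<le> mean n R"
proof -
  have "\<bar>mean n P - mean n Q\<bar> \<le> mean n (\<lambda>G. \<bar>P G - Q G\<bar>)"
    unfolding mean_diff unfolding mean_def abs_divide
    using num_nonneg[of n] by (auto intro: divide_right_mono)
  also have "\<dots> \<le> mean n R" using assms by (rule mean_mono)
  finally show ?thesis .
qed

lemma mean_one: "num n > 0 \<Longrightarrow> mean n (\<lambda>_. 1) = 1"
  by (simp add: mean_def num_def card_gt_0_iff)

lemma mean_of_bool: "mean n (\<lambda>G. of_bool (R G)) = real (card {G \<in> graphs_on C n. R G}) / num n"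
  by (simp add: mean_def of_bool_def sum.If_cases Int_def)

text \<open>For fixed \<open>h\<close> the small part contributes a constant, the large part is
  again a mean, now at \<open>n - h\<close>, and the normalisations leave a quotient of weights. If
  no member has order \<open>n - h\<close>, both sides are 0.\<close>

lemma mean_csum_cut:
  assumes "h \<le> n" "num n > 0" "invariant P" "invariant Q"
  shows "mean n (csum h n (split_prod P Q)) = sum P (graphs_on C h) / fact h * (weight (n - h) / weight n) * mean (n - h) Q"
proof -
  have "sum (csum h n (split_prod P Q)) (graphs_on C n) =
      (\<Sum>G\<in>graphs_on C n. \<Sum>S | (S \<subseteq> {1..n} \<and> card S = h) \<and> closed_in G S.
      P (induced G S) * Q (induced G ({1..n} - S)))"
    by (intro sum.cong refl) (simp add: csum_def split_prod_def graphs_onD(2))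
  also have "\<dots> = real (n choose h) * (sum P (graphs_on C h) * sum Q (graphs_on C (n - h)))"
    by (rule sum_closed_graphs_on[OF assms(3,4)])
  also have "real (n choose h) = fact n / (fact h * fact (n - h))"
    by (rule binomial_fact[OF assms(1)])
  finally have eq: "sum (csum h n (split_prod P Q)) (graphs_on C n) =
      fact n / (fact h * fact (n - h)) * (sum P (graphs_on C h) * sum Q (graphs_on C (n - h)))" .
  show ?thesis
  proof (cases "num (n - h) = 0")
    case True
    then have "graphs_on C (n - h) = {}" by (simp add: num_def)
    then show ?thesis by (simp add: mean_def eq)
  next
    case False
    then show ?thesis
      unfolding mean_def[of n] mean_def[of "n - h"] eq weight_def
      using assms(2) by (simp add: field_simps)
  qed
qed

text \<open>Once known to be positive, this is the inverse of the radius of convergence of the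
  exponential generating function.\<close>

definition growth :: real where
  "growth = lim (\<lambda>n. weight (Suc n) / weight n)"

lemma weight_ratio: "(\<lambda>n. weight (Suc n) / weight n) \<longlonglongrightarrow> growth"
proof -
  obtain L where "(\<lambda>n. num n / (real n * num (n - 1))) \<longlonglongrightarrow> L"
    using smooth unfolding smooth_def num_def by blast
  then have "(\<lambda>n. num (Suc n) / (real (Suc n) * num (Suc n - 1))) \<longlonglongrightarrow> L"
    by (rule LIMSEQ_Suc)
  moreover have "num (Suc n) / (real (Suc n) * num (Suc n - 1)) = weight (Suc n) / weight n" for n
    by (simp add: weight_def field_simps del: of_nat_Suc)
  ultimately show ?thesis
    unfolding growth_def by (simp add: limI)
qed

lemma weight_ratio_power: "(\<lambda>n. weight (n + h) / weight n) \<longlonglongrightarrow> growth ^ h"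
proof (induction h)
  case 0
  have "\<forall>\<^sub>F n in sequentially. weight (n + 0) / weight n = 1"
    using weight_pos by eventually_elim simp
  then show ?case by (simp add: tendsto_eventually)
next
  case (Suc h)
  have "(\<lambda>n. weight (Suc (n + h)) / weight (n + h) * (weight (n + h) / weight n)) \<longlonglongrightarrow> growth * growth ^ h"
    by (intro tendsto_mult Suc LIMSEQ_ignore_initial_segment[OF weight_ratio])
  moreover have "\<forall>\<^sub>F n in sequentially. weight (Suc (n + h)) / weight (n + h) * (weight (n + h) / weight n)
      = weight (n + Suc h) / weight n"
  proof -
    have "\<forall>\<^sub>F n in sequentially. weight (n + h) > 0"
      using weight_pos by (subst eventually_sequentially_seg) 
    then show ?thesis by eventually_elim simp
  qed
  ultimately have "(\<lambda>n. weight (n + Suc h) / weight n) \<longlonglongrightarrow> growth * growth ^ h"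
    by (rule Lim_transform_eventually)
  then show ?case by simp
qed

definition conn :: "nat graph \<Rightarrow> real" where
  "conn G = of_bool (graph_connected G)"

lemma invariant_conn: "invariant conn"
  unfolding conn_def by (rule invariant_compose[OF invariant_connected])

lemma mean_conn_ge:
  assumes "n > 0" "num n > 0"
  shows "mean n conn \<ge> 1 / 54"
proof -
  have "num n \<le> 54 * real (card {G \<in> graphs_on C n. graph_connected G})"
    using connected_count[OF assms(1)] unfolding num_def by linarith
  then show ?thesis
    using assms(2) unfolding conn_def mean_of_bool by (simp add: field_simps)
qed

lemma csum_conn_le:
  assumes "G \<in> graphs_on C n" "2 * h < n"
  shows "csum h n (split_prod (\<lambda>_. 1) conn) G \<le> 1"
proof -
  note G = graphs_onD[OF assms(1)]
  let ?F = "{S. (S \<subseteq> {1..n} \<and> card S = h) \<and> closed_in G S}"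
  have fin: "finite ?F" by (rule finite_subset[of _ "Pow {1..n}"]) auto
  have "csum h n (split_prod (\<lambda>_. 1) conn) G = real (card {S \<in> ?F. graph_connected (induced G ({1..n} - S))})"
    using fin by (simp add: csum_def split_prod_def conn_def G(2) of_bool_def sum.If_cases Int_def)
  also have "card {S \<in> ?F. graph_connected (induced G ({1..n} - S))} \<le> card (fragments n h G)"
    by (rule card_mono[OF finite_fragments]) (auto simp: fragments_def)
  also have "card (fragments n h G) \<le> 1" using card_fragments_le[OF G(3,2) assms(2)] .
  finally show ?thesis by simp
qed

text \<open>The expected number of closed sets of order \<open>f\<close> with connected complement
  is at most 1, by uniqueness of fragments. By the splitting formula it is at least
  \<open>weight f * (weight n / weight (n + f)) / 54\<close>, which bounds \<open>growth ^ f\<close>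
  from below by \<open>weight f / 54\<close>.\<close>

lemma growth_pos: "growth > 0"
proof -
  have nonneg: "growth \<ge> 0"
    using weight_ratio by (rule LIMSEQ_le_const) (simp add: weight_nonneg)
  obtain N where N: "\<And>n. n \<ge> N \<Longrightarrow> num n > 0"
    using num_pos unfolding eventually_sequentially by blast
  \<comment> \<open>Beyond \<open>N\<close> all weights are positive; \<open>f > 0\<close> is needed
    so that \<open>growth ^ f > 0\<close> excludes \<open>growth = 0\<close>.\<close>
  define f where "f = Suc N"
  have "weight f / 54 \<le> weight (n + f) / weight n" if n: "n \<ge> Suc f" for n
  proof -
    have pos: "num (n + f) > 0" "num n > 0" "weight n > 0" "weight (n + f) > 0" "weight f > 0"
      using N n by (simp_all add: f_def weight_def)
    have "mean (n + f) (csum f (n + f) (split_prod (\<lambda>_. 1) conn)) \<le> mean (n + f) (\<lambda>_. 1)"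
      using n by (intro mean_mono csum_conn_le) auto
    then have "sum (\<lambda>_. 1) (graphs_on C f) / fact f * (weight n / weight (n + f)) * mean n conn \<le> 1"
      unfolding mean_one[OF pos(1)]
      using mean_csum_cut[OF _ pos(1) invariant_const[of 1] invariant_conn, of f] by simp
    then have 1: "weight f * (weight n / weight (n + f)) * mean n conn \<le> 1"
      by (simp add: weight_def num_def)
    have "weight f * (weight n / weight (n + f)) * (1 / 54) \<le> weight f * (weight n / weight (n + f)) * mean n conn"
      using mean_conn_ge[of n] n pos by (intro mult_left_mono) auto
    with 1 have "weight f * (weight n / weight (n + f)) * (1 / 54) \<le> 1" by linarith
    then show ?thesis using pos by (simp add: field_simps)
  qed
  then have "weight f / 54 \<le> growth ^ f"
    using LIMSEQ_le_const[OF weight_ratio_power[of f]] by blast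
  moreover have "weight f > 0" using N[of f] by (simp add: f_def weight_def)
  ultimately have "growth ^ f > 0" by simp
  then have "growth \<noteq> 0" by (auto simp: f_def)
  with nonneg show ?thesis by simp
qed

lemma weight_ratio_inverse: "(\<lambda>n. weight (n - h) / weight n) \<longlonglongrightarrow> 1 / growth ^ h"
proof -
  have "(\<lambda>n. inverse (weight (n + h) / weight n)) \<longlonglongrightarrow> inverse (growth ^ h)"
    using weight_ratio_power growth_pos by (intro tendsto_inverse) auto
  then have "(\<lambda>n. weight (n + h - h) / weight (n + h)) \<longlonglongrightarrow> 1 / growth ^ h"
    by (simp add: inverse_eq_divide)
  then show ?thesis by (rule LIMSEQ_offset)
qed

lemma mean_csum_cut_limit:
  assumes "invariant P" "invariant Q" "(\<lambda>n. mean n Q) \<longlonglongrightarrow> e"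
  shows "(\<lambda>n. mean n (csum h n (split_prod P Q))) \<longlonglongrightarrow> sum P (graphs_on C h) / fact h * (1 / growth ^ h) * e"
proof -
  have "(\<lambda>n. mean (n - h) Q) \<longlonglongrightarrow> e"
    by (rule LIMSEQ_offset[of _ h]) (simp add: assms(3))
  then have "(\<lambda>n. sum P (graphs_on C h) / fact h * (weight (n - h) / weight n) * mean (n - h) Q)
      \<longlonglongrightarrow> sum P (graphs_on C h) / fact h * (1 / growth ^ h) * e"
    by (intro tendsto_mult tendsto_const weight_ratio_inverse)
  moreover have "\<forall>\<^sub>F n in sequentially. sum P (graphs_on C h) / fact h * (weight (n - h) / weight n) * mean (n - h) Q
      = mean n (csum h n (split_prod P Q))"
    using num_pos eventually_ge_at_top[of h] by eventually_elim (simp add: mean_csum_cut assms)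
  ultimately show ?thesis by (rule Lim_transform_eventually)
qed

section \<open>Factorial moments and the probability of connectedness\<close>

definition ncomp :: "nat \<Rightarrow> nat graph \<Rightarrow> nat" where
  "ncomp K G = card (small_components K G)"

lemma invariant_ncomp: "invariant (ncomp K)"
  using invariant_small_components by (simp add: ncomp_def[abs_def])

text \<open>Marking a small component in two ways: first choose \<open>j + 1\<close> small components and mark one of
  them, or first choose the marked one and then \<open>j\<close> small components of the rest.\<close>

lemma choose_ncomp_rec:
  assumes "G \<in> graphs_on C n"
  shows "real (Suc j) * real (ncomp K G choose Suc j) =
    (\<Sum>h\<le>K. csum h n (split_prod conn (\<lambda>G. real (ncomp K G choose j))) G)"
proof -
  note G = graphs_onD[OF assms]
  have fin: "finite (small_components K G)" using G(2) by (simp add: finite_small_components)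
  let ?B = "{S. S \<subseteq> {1..n} \<and> closed_in G S \<and> card S \<le> K}"
  have finB: "finite ?B" by (rule finite_subset[of _ "Pow {1..n}"]) auto
  have sm: "small_components K G = {S \<in> ?B. graph_connected (induced G S)}"
    using G(2) by (auto simp: small_components_def)
  have "(\<Sum>h\<le>K. csum h n (split_prod conn (\<lambda>G. real (ncomp K G choose j))) G) =
      (\<Sum>S\<in>?B. conn (induced G S) * real (ncomp K (induced G ({1..n} - S)) choose j))"
    unfolding csum_def split_prod_def G(2) by (rule sum_by_card)
  also have "\<dots> = (\<Sum>S\<in>small_components K G. real (ncomp K (induced G ({1..n} - S)) choose j))"
    unfolding sm using finB by (intro sum.mono_neutral_cong_right) (auto simp: conn_def)
  also have "\<dots> = (\<Sum>S\<in>small_components K G. real ((ncomp K G - 1) choose j))"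
  proof (rule sum.cong[OF refl])
    fix S assume "S \<in> small_components K G"
    then have "ncomp K (induced G (verts G - S)) = ncomp K G - 1"
      unfolding ncomp_def using small_components_remove[OF G(3)] fin by simp
    then show "real (ncomp K (induced G ({1..n} - S)) choose j) = real ((ncomp K G - 1) choose j)"
      by (simp add: G(2))
  qed
  also have "\<dots> = real (ncomp K G * ((ncomp K G - 1) choose j))"
    by (simp add: ncomp_def)
  also have "ncomp K G * ((ncomp K G - 1) choose j) = Suc j * (ncomp K G choose Suc j)"
    by (cases "ncomp K G") (simp_all only: Suc_times_binomial diff_Suc_1, simp_all)
  finally show ?thesis by (simp only: of_nat_mult)
qed

text \<open>These are the factorial moments, divided by \<open>fact j\<close>, of a Poisson variable
  with mean \<open>\<mu> K\<close>. In the induction a marked component of order \<open>h\<close>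
  contributes the \<open>h\<close>-th term of \<open>\<mu> K\<close>, and division by
  \<open>j + 1\<close> undoes the choice of the mark.\<close>

lemma factorial_moment_limit:
  defines "\<mu> K \<equiv> (\<Sum>h\<le>K. sum conn (graphs_on C h) / fact h * (1 / growth ^ h))"
  shows "(\<lambda>n. mean n (\<lambda>G. real (ncomp K G choose j))) \<longlonglongrightarrow> \<mu> K ^ j / fact j"
proof (induction j)
  case 0
  have "\<forall>\<^sub>F n in sequentially. mean n (\<lambda>_. 1) = 1"
    using num_pos by eventually_elim (rule mean_one)
  then show ?case by (simp add: tendsto_eventually)
next
  case (Suc j)
  let ?Q = "\<lambda>G. real (ncomp K G choose j)"
  have inv: "invariant ?Q" by (rule invariant_compose[OF invariant_ncomp])
  have "(\<lambda>n. (\<Sum>h\<le>K. mean n (csum h n (split_prod conn ?Q))) / real (Suc j)) \<longlonglongrightarrow>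
      (\<Sum>h\<le>K. sum conn (graphs_on C h) / fact h * (1 / growth ^ h) * (\<mu> K ^ j / fact j)) / real (Suc j)"
    by (intro tendsto_divide tendsto_sum tendsto_const mean_csum_cut_limit invariant_conn inv Suc) simp
  moreover have "(\<Sum>h\<le>K. sum conn (graphs_on C h) / fact h * (1 / growth ^ h) * (\<mu> K ^ j / fact j)) / real (Suc j)
      = \<mu> K ^ Suc j / fact (Suc j)"
    unfolding sum_distrib_right[symmetric] \<mu>_def[symmetric] by (simp add: field_simps)
  moreover have "(\<Sum>h\<le>K. mean n (csum h n (split_prod conn ?Q))) / real (Suc j) = mean n (\<lambda>G. real (ncomp K G choose Suc j))" for n
  proof -
    have "(\<Sum>h\<le>K. mean n (csum h n (split_prod conn ?Q))) = mean n (\<lambda>G. real (Suc j) * real (ncomp K G choose Suc j))"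
      unfolding mean_sum[symmetric] by (rule mean_cong) (simp only: choose_ncomp_rec)
    then show ?thesis unfolding mean_cmult by (simp del: of_nat_Suc)
  qed
  ultimately show ?case by simp
qed

text \<open>Inclusion-exclusion is cut off at a fixed \<open>N\<close> before \<open>n\<close>
  grows, so no infinite sum is exchanged with the limit. The error is at most the moment of index
  \<open>Suc N\<close>, whose limit is below \<open>e\<close>.\<close>

lemma convergent_no_small_components: "convergent (\<lambda>n. mean n (\<lambda>G. of_bool (ncomp K G = 0)))"
proof (rule convergent_approx)
  fix e :: real assume e: "e > 0"
  define \<mu> where "\<mu> = (\<Sum>h\<le>K. sum conn (graphs_on C h) / fact h * (1 / growth ^ h))"
  have lim: "(\<lambda>n. mean n (\<lambda>G. real (ncomp K G choose j))) \<longlonglongrightarrow> \<mu> ^ j / fact j" for j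
    unfolding \<mu>_def by (rule factorial_moment_limit)
  have "(\<lambda>j. \<mu> ^ j / fact j) \<longlonglongrightarrow> 0"
    using summable_LIMSEQ_zero[OF summable_exp[of \<mu>]] by (simp add: field_simps)
  then have "\<forall>\<^sub>F j in sequentially. \<mu> ^ j / fact j < e" using e by (rule order_tendstoD(2))
  then obtain N where "\<And>j. j \<ge> N \<Longrightarrow> \<mu> ^ j / fact j < e" unfolding eventually_sequentially by blast
  then have J: "\<mu> ^ Suc N / fact (Suc N) < e" by (metis le_SucI order_refl)
  define y where "y n = (\<Sum>j\<le>N. (- 1) ^ j * mean n (\<lambda>G. real (ncomp K G choose j)))" for n
  have "convergent y"
    unfolding y_def by (intro convergent_sum convergentI[OF tendsto_mult[OF tendsto_const lim]])
  moreover have "\<forall>\<^sub>F n in sequentially. mean n (\<lambda>G. real (ncomp K G choose Suc N)) < e"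
    using lim[of "Suc N"] J by (rule order_tendstoD(2))
  then have "\<forall>\<^sub>F n in sequentially. \<bar>mean n (\<lambda>G. of_bool (ncomp K G = 0)) - y n\<bar> \<le> e"
  proof eventually_elim
    case (elim n)
    have "y n = mean n (\<lambda>G. \<Sum>j\<le>N. (- 1) ^ j * real (ncomp K G choose j))"
      by (simp add: y_def mean_sum mean_cmult)
    then have "\<bar>mean n (\<lambda>G. of_bool (ncomp K G = 0)) - y n\<bar> \<le> mean n (\<lambda>G. real (ncomp K G choose Suc N))"
      by (simp only:) (intro mean_abs_diff bonferroni)
    with elim show ?case by linarith
  qed
  ultimately show "\<exists>y. convergent y \<and>
      (\<forall>\<^sub>F n in sequentially. \<bar>mean n (\<lambda>G. of_bool (ncomp K G = 0)) - y n\<bar> \<le> e)"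
    by blast
qed

lemma mean_no_fragment:
  assumes "n > 0" "num n > 0"
  shows "mean n (\<lambda>G. of_bool (fragments n K G = {})) \<le> 2 / real (Suc K)"
proof -
  have "{G \<in> graphs_on C n. fragments n K G = {}} = {G \<in> graphs_on C n.
      \<forall>S\<subseteq>{1..n}. closed_in G S \<longrightarrow> card S \<le> K \<longrightarrow> \<not> graph_connected (induced G ({1..n} - S))}"
    by (auto simp: fragments_def)
  then have "Suc K * card {G \<in> graphs_on C n. fragments n K G = {}} \<le> 2 * card (graphs_on C n)"
    using fragment_tail[OF assms(1), of K] by simp
  then have "real (Suc K * card {G \<in> graphs_on C n. fragments n K G = {}}) \<le> real (2 * card (graphs_on C n))"
    by (rule of_nat_mono)
  then have "real (Suc K) * real (card {G \<in> graphs_on C n. fragments n K G = {}}) \<le> 2 * num n"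
    unfolding num_def by (simp only: of_nat_mult of_nat_numeral)
  then show ?thesis
    unfolding mean_of_bool using assms(2) by (simp add: field_simps del: of_nat_Suc)
qed

text \<open>If a fragment exists, connectedness is the absence of components of order at most
  \<open>K\<close>: a nonempty fragment contains such a component, and the only component of a
  connected graph has order \<open>n > K\<close>.\<close>

lemma conn_approx:
  assumes "G \<in> graphs_on C n" "K < n"
  shows "\<bar>conn G - of_bool (ncomp K G = 0)\<bar> \<le> of_bool (fragments n K G = {})"
proof -
  note G = graphs_onD[OF assms(1)]
  have fin: "finite (small_components K G)" using G(2) by (simp add: finite_small_components)
  have ne: "{1..n} \<noteq> {}" using assms(2) by simp
  have 1: "ncomp K G = 0" if conn: "graph_connected G"
  proof -
    have "S \<notin> small_components K G" for S
    proof
      assume S: "S \<in> small_components K G"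
      then have "S \<noteq> {}" "S \<subseteq> verts G" "closed_in G S" "card S \<le> K"
        using small_components_nonempty[OF S] by (simp_all add: small_components_def)
      then have "S = {1..n}" using connected_closed[OF conn, of S] G(2) by blast
      then show False using \<open>card S \<le> K\<close> assms(2) by simp
    qed
    then have "small_components K G = {}" by blast
    then show ?thesis by (simp add: ncomp_def)
  qed
  have 2: "graph_connected G" if 0: "ncomp K G = 0" and S: "S \<in> fragments n K G" for S
  proof -
    have "S = {}"
    proof (rule ccontr)
      assume "S \<noteq> {}"
      then obtain u where "u \<in> S" by blast
      with S G(2) have u: "u \<in> S" "u \<in> verts G" by (auto simp: fragments_def)
      have "cls G u \<subseteq> S"
        using S u closed_in_rtrancl[of G S u] by (auto simp: cls_def fragments_def)
      moreover have "finite S" "card S \<le> K" using S finite_subset[of S "{1..n}"] by (auto simp: fragments_def)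
      ultimately have "card (cls G u) \<le> K" using card_mono[of S "cls G u"] by simp
      then have "cls G u \<in> small_components K G"
        using closed_in_cls[OF G(3)] cls_subset[of G u] connected_induced_cls[OF G(3) u(2)]
        by (simp add: small_components_def)
      then show False using 0 fin by (auto simp: ncomp_def)
    qed
    then have "graph_connected (induced G (verts G))" using S G(2) by (simp add: fragments_def)
    moreover have "induced G (verts G) = G"
      using G(3) by (intro prod_eqI) (auto simp: simple_graph_def)
    ultimately show ?thesis by simp
  qed
  show ?thesis using 1 2 by (auto simp: conn_def)
qed

lemma convergent_conn: "convergent (\<lambda>n. mean n conn)"
proof (rule convergent_approx)
  fix e :: real assume e: "e > 0"
  obtain K where K: "2 / e < real K" using reals_Archimedean2 by blast
  then have "2 / real (Suc K) \<le> e" using e by (simp add: field_simps)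
  moreover have "\<forall>\<^sub>F n in sequentially. \<bar>mean n conn - mean n (\<lambda>G. of_bool (ncomp K G = 0))\<bar> \<le> 2 / real (Suc K)"
    using num_pos eventually_gt_at_top[of K]
  proof eventually_elim
    case (elim n)
    have "\<bar>mean n conn - mean n (\<lambda>G. of_bool (ncomp K G = 0))\<bar> \<le> mean n (\<lambda>G. of_bool (fragments n K G = {}))"
      using elim by (intro mean_abs_diff conn_approx)
    also have "\<dots> \<le> 2 / real (Suc K)" using elim by (intro mean_no_fragment) auto
    finally show ?case .
  qed
  ultimately have "\<forall>\<^sub>F n in sequentially. \<bar>mean n conn - mean n (\<lambda>G. of_bool (ncomp K G = 0))\<bar> \<le> e"
    by (auto elim: eventually_mono)
  then show "\<exists>y. convergent y \<and> (\<forall>\<^sub>F n in sequentially. \<bar>mean n conn - y n\<bar> \<le> e)"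
    using convergent_no_small_components by blast
qed

section \<open>The typical type and the limit law for sentences\<close>

definition atypical :: "nat \<Rightarrow> ty \<Rightarrow> nat graph \<Rightarrow> real" where
  "atypical k t G = of_bool (graph_connected G \<and> utyp k G \<noteq> t)"

text \<open>\<open>t\<close> is the unrooted type of an absorbing graph \<open>M\<close>, so a
  connected graph of another type has no pendant copy of \<open>M\<close>. After normalisation the
  label choices turn into a convergent quotient of weights, and the choice of the attachment vertex
  leaves the factor \<open>1 / n\<close>.\<close>

lemma ex_typical: "\<exists>t. (\<lambda>n. mean n (atypical k t)) \<longlonglongrightarrow> 0"
proof -
  obtain N where N: "\<And>n. n \<ge> N \<Longrightarrow> num n > 0"
    using num_pos unfolding eventually_sequentially by blast
  have "mean (Suc N) conn > 0" using mean_conn_ge[of "Suc N"] N[of "Suc N"] by simp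
  then have "\<exists>G\<in>graphs_on C (Suc N). graph_connected G"
    by (rule contrapos_pp) (simp add: mean_def conn_def)
  then obtain G0 where "G0 \<in> C" "graph_connected G0" using graphs_onD by blast
  then obtain M r where M: "M \<in> C" "graph_connected M" "r \<in> verts M"
    "\<And>t. t \<in> rtypes k \<Longrightarrow> glue (rtype k M r) t = rtype k M r"
    using ex_absorbing_graph[of G0 k] by blast
  let ?m = "card (verts M)" and ?t = "utyp k M"
  have bound: "mean n (atypical k ?t) \<le> weight (n + ?m) / weight n * (fact ?m / real n)" if n: "n > max N ?m" for n
  proof -
    let ?b = "card {G \<in> graphs_on C n. graph_connected G \<and> utyp k G \<noteq> ?t}"
    have pos: "num n > 0" "n > 0" using N[of n] n by auto
    have free: "\<not> pendant M r G S f v" if "G \<in> C" "graph_connected G" "utyp k G \<noteq> ?t" for G S f v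
      using utyp_if_pendant[OF M that(1,2)] that(3) by blast
    have "((n + ?m) choose ?m) * (?b * n) \<le> card (graphs_on C (n + ?m))"
      by (rule pendant_free_count[OF M(1-3) invariant_compose[OF invariant_utyp] free]) (use n in auto)
    then have "real (((n + ?m) choose ?m) * (?b * n)) \<le> real (card (graphs_on C (n + ?m)))"
      by (rule of_nat_mono)
    then have "real ((n + ?m) choose ?m) * (real ?b * real n) \<le> num (n + ?m)"
      unfolding num_def by (simp only: of_nat_mult)
    moreover have "real ((n + ?m) choose ?m) = fact (n + ?m) / (fact ?m * fact n)"
      using binomial_fact[of ?m "n + ?m"] by simp
    ultimately have "fact (n + ?m) / (fact ?m * fact n) * (real ?b * real n) \<le> num (n + ?m)" by simp
    then have "real ?b \<le> num (n + ?m) / fact (n + ?m) * fact n * (fact ?m / real n)"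
      using pos by (simp add: field_simps)
    then have "real ?b / num n \<le> num (n + ?m) / fact (n + ?m) * fact n * (fact ?m / real n) / num n"
      using pos by (intro divide_right_mono) auto
    also have "\<dots> = weight (n + ?m) / weight n * (fact ?m / real n)"
      by (simp add: weight_def)
    finally show ?thesis unfolding atypical_def mean_of_bool .
  qed
  have "(\<lambda>n. weight (n + ?m) / weight n * (fact ?m / real n)) \<longlonglongrightarrow> growth ^ ?m * 0"
    by (intro tendsto_mult weight_ratio_power lim_const_over_n)
  then have "(\<lambda>n. weight (n + ?m) / weight n * (fact ?m / real n)) \<longlonglongrightarrow> 0" by simp
  then have "(\<lambda>n. mean n (atypical k ?t)) \<longlonglongrightarrow> 0"
  proof (rule tendsto_sandwich[rotated 3])
    show "\<forall>\<^sub>F n in sequentially. 0 \<le> mean n (atypical k ?t)"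
      by (simp add: mean_nonneg atypical_def)
    show "\<forall>\<^sub>F n in sequentially. mean n (atypical k ?t) \<le> weight (n + ?m) / weight n * (fact ?m / real n)"
      using eventually_gt_at_top[of "max N ?m"] by eventually_elim (rule bound)
  qed simp
  then show ?thesis by blast
qed

lemma invariant_atypical: "invariant (atypical k t)"
  unfolding atypical_def
  by (rule invariant_compose2[OF invariant_connected invariant_utyp, of "\<lambda>c u. of_bool (c \<and> u \<noteq> t)"])

definition typical :: "nat \<Rightarrow> ty \<Rightarrow> nat graph \<Rightarrow> real" where
  "typical k t G = of_bool (graph_connected G \<and> utyp k G = t)"

lemma invariant_typical: "invariant (typical k t)"
  unfolding typical_def
  by (rule invariant_compose2[OF invariant_connected invariant_utyp, of "\<lambda>c u. of_bool (c \<and> u = t)"])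

text \<open>Truth of a sentence as a property of its type, so that it can be evaluated at
  \<open>glue t u\<close> when only the type \<open>u\<close> of the small part varies.\<close>

definition holds :: "mso \<Rightarrow> ty \<Rightarrow> bool" where
  "holds \<phi> t \<longleftrightarrow> (\<exists>G :: nat graph. simple_graph G \<and> utyp (qrank \<phi>) G = t \<and> models G \<phi>)"

lemma holds_utyp:
  assumes "mso_sentence \<phi>" "simple_graph (G :: nat graph)"
  shows "holds \<phi> (utyp (qrank \<phi>) G) \<longleftrightarrow> models G \<phi>"
  using models_utyp[OF _ assms(2,1)] assms(2) unfolding holds_def by blast

lemma typical_limit:
  assumes "(\<lambda>n. mean n conn) \<longlonglongrightarrow> q" "(\<lambda>n. mean n (atypical k t)) \<longlonglongrightarrow> 0"
  shows "(\<lambda>n. mean n (typical k t)) \<longlonglongrightarrow> q"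
proof -
  have "mean n conn - mean n (atypical k t) = mean n (typical k t)" for n
    unfolding mean_diff by (rule mean_cong) (auto simp: conn_def atypical_def typical_def)
  then show ?thesis using tendsto_diff[OF assms] by simp
qed

lemma convergent_models:
  assumes "mso_sentence \<phi>"
  shows "convergent (\<lambda>n. mean n (\<lambda>G. of_bool (models G \<phi>)))"
proof (rule convergent_approx)
  fix e :: real assume e: "e > 0"
  let ?k = "qrank \<phi>"
  obtain t where t: "(\<lambda>n. mean n (atypical ?k t)) \<longlonglongrightarrow> 0" using ex_typical by blast
  obtain q where q: "(\<lambda>n. mean n conn) \<longlonglongrightarrow> q" using convergent_conn by (auto simp: convergent_def)
  \<comment> \<open>Summing \<open>f G\<close> over the closed sets of order at most
    \<open>K\<close> gives the indicator of \<open>\<phi>\<close> times the number of fragments,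
    which is 1 outside an event of small probability.\<close>
  define f where "f G S = of_bool (models G \<phi>) * conn (induced G (verts G - S))" for G S
  define good where "good G = (of_bool (holds \<phi> (glue t (utyp ?k G))) :: real)" for G :: "nat graph"
  have inv: "invariant good"
    unfolding good_def by (rule invariant_compose[OF invariant_utyp])
  \<comment> \<open>The indicator of \<open>\<phi>\<close> is not a product over the two parts, but
    it becomes one when the large part has type \<open>t\<close>: then only the type of the small
    part matters. A connected large part of another type is charged to
    \<open>atypical\<close>.\<close>
  have pointwise: "\<bar>f G S - split_prod good (typical ?k t) G S\<bar> \<le> split_prod (\<lambda>_. 1) (atypical ?k t) G S"
    if G: "G \<in> graphs_on C n" and S: "S \<subseteq> {1..n}" "closed_in G S" for G S n
  proof -
    note Gs = graphs_onD[OF G]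
    let ?H = "induced G (verts G - S)" and ?F = "induced G S"
    have s: "simple_graph ?H" "simple_graph ?F" "verts ?H \<inter> verts ?F = {}"
      using S Gs by (auto intro: simple_induced)
    have "utyp ?k G = glue (utyp ?k ?H) (utyp ?k ?F)"
      using utyp_join[OF s, of ?k] join_induced[OF Gs(3) _ S(2)] join_commute[of ?H "{}" ?F "{}"] S(1) Gs(2)
      by simp
    then have "models G \<phi> \<longleftrightarrow> holds \<phi> (glue t (utyp ?k ?F))" if "utyp ?k ?H = t"
      using holds_utyp[OF assms Gs(3)] that by simp
    then show ?thesis
      by (auto simp: f_def split_prod_def good_def typical_def atypical_def conn_def)
  qed
  have conv: "convergent (\<lambda>n. mean n (csum h n f))" for h
  proof -
    have lim: "(\<lambda>n. mean n (csum h n (split_prod good (typical ?k t)))) \<longlonglongrightarrow>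
        sum good (graphs_on C h) / fact h * (1 / growth ^ h) * q"
      by (intro mean_csum_cut_limit inv invariant_typical typical_limit[OF q t])
    have "(\<lambda>n. mean n (csum h n (split_prod (\<lambda>_. 1) (atypical ?k t)))) \<longlonglongrightarrow>
        sum (\<lambda>_. 1) (graphs_on C h) / fact h * (1 / growth ^ h) * 0"
      by (intro mean_csum_cut_limit invariant_const invariant_atypical t)
    then have lim0: "(\<lambda>n. mean n (csum h n (split_prod (\<lambda>_. 1) (atypical ?k t)))) \<longlonglongrightarrow> 0" by simp
    have "\<bar>mean n (csum h n f) - mean n (csum h n (split_prod good (typical ?k t)))\<bar>
        \<le> mean n (csum h n (split_prod (\<lambda>_. 1) (atypical ?k t)))" for n
    proof (rule mean_abs_diff)
      fix G assume G: "G \<in> graphs_on C n"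
      have "\<bar>csum h n f G - csum h n (split_prod good (typical ?k t)) G\<bar> \<le>
          (\<Sum>S | (S \<subseteq> {1..n} \<and> card S = h) \<and> closed_in G S. \<bar>f G S - split_prod good (typical ?k t) G S\<bar>)"
        unfolding csum_def sum_subtractf[symmetric] by (rule sum_abs)
      also have "\<dots> \<le> csum h n (split_prod (\<lambda>_. 1) (atypical ?k t)) G"
        unfolding csum_def using pointwise[OF G] by (intro sum_mono) auto
      finally show "\<bar>csum h n f G - csum h n (split_prod good (typical ?k t)) G\<bar>
          \<le> csum h n (split_prod (\<lambda>_. 1) (atypical ?k t)) G" .
    qed
    then have "(\<lambda>n. mean n (csum h n f) - mean n (csum h n (split_prod good (typical ?k t)))) \<longlonglongrightarrow> 0"
      by (intro Lim_null_comparison[OF _ lim0]) simp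
    from tendsto_add[OF this lim] show ?thesis by (auto simp: convergent_def)
  qed
  obtain K where K: "2 / e < real K" using reals_Archimedean2 by blast
  then have Ke: "2 / real (Suc K) \<le> e" using e by (simp add: field_simps)
  have "convergent (\<lambda>n. \<Sum>h\<le>K. mean n (csum h n f))" by (intro convergent_sum conv)
  moreover have "\<forall>\<^sub>F n in sequentially. \<bar>mean n (\<lambda>G. of_bool (models G \<phi>)) - (\<Sum>h\<le>K. mean n (csum h n f))\<bar> \<le> e"
    using num_pos eventually_gt_at_top[of "2 * K"]
  proof eventually_elim
    case (elim n)
    have "\<bar>mean n (\<lambda>G. of_bool (models G \<phi>)) - mean n (\<lambda>G. \<Sum>h\<le>K. csum h n f G)\<bar>
        \<le> mean n (\<lambda>G. of_bool (fragments n K G = {}))"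
    proof (rule mean_abs_diff)
      fix G assume G: "G \<in> graphs_on C n"
      note Gs = graphs_onD[OF G]
      let ?B = "{S. S \<subseteq> {1..n} \<and> closed_in G S \<and> card S \<le> K}"
      have finB: "finite ?B" by (rule finite_subset[of _ "Pow {1..n}"]) auto
      have "(\<Sum>h\<le>K. csum h n f G) = (\<Sum>S\<in>?B. f G S)"
        unfolding csum_def by (rule sum_by_card)
      also have "\<dots> = (\<Sum>S\<in>fragments n K G. of_bool (models G \<phi>))"
        using finB by (intro sum.mono_neutral_cong_right) (auto simp: f_def conn_def fragments_def Gs(2))
      also have "\<dots> = real (card (fragments n K G)) * of_bool (models G \<phi>)" by simp
      finally have eq: "(\<Sum>h\<le>K. csum h n f G) = real (card (fragments n K G)) * of_bool (models G \<phi>)" .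
      show "\<bar>of_bool (models G \<phi>) - (\<Sum>h\<le>K. csum h n f G)\<bar> \<le> of_bool (fragments n K G = {})"
      proof (cases "fragments n K G = {}")
        case True
        then show ?thesis by (simp add: eq)
      next
        case False
        then have "card (fragments n K G) = 1"
          using card_fragments_le[OF Gs(3,2) elim(2)] finite_fragments[of n K G] card_gt_0_iff[of "fragments n K G"]
          by linarith
        then show ?thesis by (simp add: eq)
      qed
    qed
    also have "\<dots> \<le> 2 / real (Suc K)" using elim by (intro mean_no_fragment) auto
    finally show ?case using Ke unfolding mean_sum by linarith
  qed
  ultimately show "\<exists>y. convergent y \<and>
      (\<forall>\<^sub>F n in sequentially. \<bar>mean n (\<lambda>G. of_bool (models G \<phi>)) - y n\<bar> \<le> e)"
    by blast
qed

text \<open>Connected graphs of type \<open>t\<close> have limiting probability \<open>q\<close>,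
  and they all satisfy \<open>\<phi>\<close> or all refute it.\<close>

lemma models_limit_extreme:
  assumes "mso_sentence \<phi>" "(\<lambda>n. mean n (\<lambda>G. of_bool (models G \<phi>))) \<longlonglongrightarrow> p" "(\<lambda>n. mean n conn) \<longlonglongrightarrow> q"
  shows "p \<le> 1 - q \<or> q \<le> p"
proof -
  let ?k = "qrank \<phi>"
  obtain t where t: "(\<lambda>n. mean n (atypical ?k t)) \<longlonglongrightarrow> 0" using ex_typical by blast
  have models: "models G \<phi> \<longleftrightarrow> holds \<phi> t" if "G \<in> graphs_on C n" "utyp ?k G = t" for G n
    using holds_utyp[OF assms(1) graphs_onD(3)[OF that(1)]] that(2) by simp
  show ?thesis
  proof (cases "holds \<phi> t")
    case True
    have "mean n (typical ?k t) \<le> mean n (\<lambda>G. of_bool (models G \<phi>))" for n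
      by (rule mean_mono) (use models True in \<open>auto simp: typical_def\<close>)
    then have "q \<le> p"
      using LIMSEQ_le[OF typical_limit[OF assms(3) t] assms(2)] by blast
    then show ?thesis ..
  next
    case False
    have "(\<lambda>n. 1 - mean n (typical ?k t)) \<longlonglongrightarrow> 1 - q"
      by (intro tendsto_diff tendsto_const typical_limit[OF assms(3) t])
    moreover have "\<forall>\<^sub>F n in sequentially. mean n (\<lambda>G. of_bool (models G \<phi>)) \<le> 1 - mean n (typical ?k t)"
      using num_pos
    proof eventually_elim
      case (elim n)
      have "mean n (\<lambda>G. of_bool (models G \<phi>)) \<le> mean n (\<lambda>G. 1 - typical ?k t G)"
        by (rule mean_mono) (use models False in \<open>auto simp: typical_def\<close>)
      also have "\<dots> = 1 - mean n (typical ?k t)" 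
        using mean_diff[of n "\<lambda>_. 1" "typical ?k t"] mean_one[OF elim] by simp
      finally show ?case .
    qed
    ultimately have "p \<le> 1 - q"
      using tendsto_le[OF sequentially_bot _ assms(2)] by blast
    then show ?thesis ..
  qed
qed

section \<open>Transfer to the random graph\<close>

lemma prob_eq_mean:
  assumes "num n > 0"
  shows "measure_pmf.prob (random_graph C n) {G. R G} = mean n (\<lambda>G. of_bool (R G))"
proof -
  have "graphs_on C n \<noteq> {}" using assms by (auto simp: num_def)
  then have "measure_pmf.prob (random_graph C n) {G. R G} = real (card (graphs_on C n \<inter> {G. R G})) / num n"
    unfolding random_graph_def num_def by (simp add: measure_pmf_of_set)
  also have "graphs_on C n \<inter> {G. R G} = {G \<in> graphs_on C n. R G}" by auto
  finally show ?thesis by (simp add: mean_of_bool)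
qed

text \<open>By smoothness only finitely many orders carry no graph, so the values at which
  \<open>random_graph\<close> is not meaningful do not affect the limit.\<close>

lemma prob_tendsto_iff:
  "(\<lambda>n. measure_pmf.prob (random_graph C n) {G. R G}) \<longlonglongrightarrow> p \<longleftrightarrow>
   (\<lambda>n. mean n (\<lambda>G. of_bool (R G))) \<longlonglongrightarrow> p"
  by (rule tendsto_cong) (use num_pos in eventually_elim, rule prob_eq_mean)

end

theorem theorem25:
  fixes C :: "nat graph set"
  assumes "graph_class C" and "smooth C" and "addable C"
  shows "\<exists>c::real.
    (\<lambda>n. measure_pmf.prob (random_graph C n) {G. \<not> graph_connected G}) \<longlonglongrightarrow> c \<and>
    (\<forall>\<phi>. mso_sentence \<phi> \<longrightarrow>
      (\<exists>p::real. (\<lambda>n. measure_pmf.prob (random_graph C n) {G. models G \<phi>}) \<longlonglongrightarrow> p \<and>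
        (p \<le> c \<or> p \<ge> 1 - c)))"
proof -
  interpret smooth_class C by unfold_locales (use assms in auto)
  obtain q where q: "(\<lambda>n. mean n conn) \<longlonglongrightarrow> q"
    using convergent_conn by (auto simp: convergent_def)
  \<comment> \<open>The witness for \<open>c\<close> is \<open>1 - q\<close>; the alternative
    \<open>p \<ge> 1 - c\<close> is then \<open>q \<le> p\<close>.\<close>
  have "(\<lambda>n. 1 - mean n conn) \<longlonglongrightarrow> 1 - q" by (intro tendsto_diff tendsto_const q)
  moreover have "\<forall>\<^sub>F n in sequentially. 1 - mean n conn = mean n (\<lambda>G. of_bool (\<not> graph_connected G))"
    using num_pos
  proof eventually_elim
    case (elim n)
    have "1 - mean n conn = mean n (\<lambda>G. 1 - conn G)"
      using mean_diff[of n "\<lambda>_. 1" conn] mean_one[OF elim] by simp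
    also have "\<dots> = mean n (\<lambda>G. of_bool (\<not> graph_connected G))"
      by (rule mean_cong) (simp add: conn_def)
    finally show ?case .
  qed
  ultimately have "(\<lambda>n. mean n (\<lambda>G. of_bool (\<not> graph_connected G))) \<longlonglongrightarrow> 1 - q"
    by (rule Lim_transform_eventually)
  moreover have "\<exists>p. (\<lambda>n. mean n (\<lambda>G. of_bool (models G \<phi>))) \<longlonglongrightarrow> p \<and> (p \<le> 1 - q \<or> p \<ge> 1 - (1 - q))"
    if \<phi>: "mso_sentence \<phi>" for \<phi>
  proof -
    obtain p where p: "(\<lambda>n. mean n (\<lambda>G. of_bool (models G \<phi>))) \<longlonglongrightarrow> p"
      using convergent_models[OF \<phi>] by (auto simp: convergent_def)
    then show ?thesis using models_limit_extreme[OF \<phi> p q] by auto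
  qed
  ultimately show ?thesis unfolding prob_tendsto_iff by blast
qed

end
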